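(* Let $\varepsilon>0$ be a constant. There exists a constant $k_\varepsilon$ such that the following holds: if $G=(V,E)$ is a graph on $n$ vertices with minimum degree $\delta(G)\geq\left(\frac12+\varepsilon\right)n$ and $k\geq k_\varepsilon$ is a constant integer, then with high probability (as $n\to\infty$) the random graph $G_k$ is Hamiltonian.
   Context: For a fixed graph $G=(V,E)$ and a positive integer $k$, the random graph $G_k$ is obtained as follows: each vertex $v\in V$ independently chooses a uniformly random set of $k$ distinct neighbors of $v$ in $G$ (choices without replacement), and $G_k$ is the graph on $V$ whose edges are the pairs $\{v,w\}$ such that $v$ chose $w$ or $w$ chose $v$. $G$ is regarded as one member of a sequence of graphs with $n\to\infty$; "with high probability" means with probability tending to $1$ as $n\to\infty$. *)

theory Defs
  imports "HOL-Probability.Probability"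
begin

definition is_graph :: "nat \<Rightarrow> (nat \<Rightarrow> nat \<Rightarrow> bool) \<Rightarrow> bool" where
  "is_graph n E \<longleftrightarrow> (\<forall>v<n. \<forall>w<n. E v w \<longleftrightarrow> E w v) \<and> (\<forall>v<n. \<not> E v v)"

definition nbrs :: "nat \<Rightarrow> (nat \<Rightarrow> nat \<Rightarrow> bool) \<Rightarrow> nat \<Rightarrow> nat set" where
  "nbrs n E v = {w. w < n \<and> E v w}"

definition min_degree_ge :: "nat \<Rightarrow> (nat \<Rightarrow> nat \<Rightarrow> bool) \<Rightarrow> real \<Rightarrow> bool" where
  "min_degree_ge n E d \<longleftrightarrow> (\<forall>v<n. real (card (nbrs n E v)) \<ge> d)"

definition hamiltonian :: "nat \<Rightarrow> (nat \<Rightarrow> nat \<Rightarrow> bool) \<Rightarrow> bool" where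
  "hamiltonian n E \<longleftrightarrow> n \<ge> 3 \<and>
     (\<exists>p. bij_betw p {0..<n} {0..<n} \<and> (\<forall>i<n. E (p i) (p (Suc i mod n))))"

definition choice_pmf :: "nat \<Rightarrow> (nat \<Rightarrow> nat \<Rightarrow> bool) \<Rightarrow> nat \<Rightarrow> (nat \<Rightarrow> nat set) pmf" where
  "choice_pmf n E k =
     Pi_pmf {0..<n} {} (\<lambda>v. pmf_of_set {S. S \<subseteq> nbrs n E v \<and> card S = k})"

definition Gk_graph :: "(nat \<Rightarrow> nat set) \<Rightarrow> nat \<Rightarrow> nat \<Rightarrow> bool" where
  "Gk_graph c v w \<longleftrightarrow> w \<in> c v \<or> v \<in> c w"

definition prob_Gk_hamiltonian :: "nat \<Rightarrow> (nat \<Rightarrow> nat \<Rightarrow> bool) \<Rightarrow> nat \<Rightarrow> real" where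
  "prob_Gk_hamiltonian n E k =
     measure_pmf.prob (choice_pmf n E k) {c. hamiltonian n (Gk_graph c)}"

end

(*
  Split the k choices of every vertex into k1 + m + m choices (a, b, d) with m = k div 3.
  Up to probability O(1/n), any choice of k1 elements from each k-set gives a graph in which sets of
  at most n/192 vertices expand by a factor 3, and the whole graph is connected.

  If G_k is connected but not Hamiltonian, fix a longest path P.  It uses at most two choices of each
  vertex, so a fraction at least 12^-n of all splittings puts P inside the graph of the a-choices
  (the colouring argument of Fenner and Frieze).  It therefore suffices to show that, given an
  expanding a, the event that adding b and d neither lengthens a longest path nor closes one to a
  cycle has probability at most C^-n for a large constant C.

  Posa's lemma yields linearly many starting vertices x of longest paths of the a-graph, each with
  linearly many endpoints y.  By the degree condition, rotations using the b-choices of these y enlarge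
  the set of endpoints belonging to x to at least (1/2 + eps/2) n vertices, outside an event that is
  controlled by a union bound over the 2^n possible sets of missed vertices.  Hence x has linearly many
  G-neighbours among its endpoints, and all the d-choices at all the vertices x have to avoid them.
*)
theory Submission
  imports Defs
begin

section \<open>Counting configurations of choices\<close>

text \<open>The quotient of the two binomials is the product of (a - i) / (b - i) for i < k, and
  \<rho> \<le> 1 makes each factor at most \<rho>.\<close>

lemma choose_le_power_mult:
  fixes \<rho> :: real
  assumes "real a \<le> \<rho> * real b" "0 \<le> \<rho>" "\<rho> \<le> 1"
  shows "real (a choose k) \<le> \<rho> ^ k * real (b choose k)"
proof (induction k)
  case (Suc k)
  show ?case
  proof (cases "k < a")
    case True
    have ab: "a \<le> b"
      using assms mult_right_mono[of \<rho> 1 "real b"] by simp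
    have step: "real (Suc k) * real (c choose Suc k) = real (c choose k) * (real c - real k)" if "k < c" for c
    proof -
      have "Suc k * (c choose Suc k) = (c choose k) * (c - k)"
        using binomial_absorb_comp[of c k] binomial_absorption[of k "c"] by (simp add: mult.commute)
      then show ?thesis
        using that by (metis of_nat_diff of_nat_mult less_imp_le_nat)
    qed
    have "real (Suc k) * real (a choose Suc k) = real (a choose k) * (real a - real k)"
      by (rule step[OF True])
    also have "\<dots> \<le> (\<rho> ^ k * real (b choose k)) * (\<rho> * (real b - real k))"
    proof (rule mult_mono[OF Suc])
      show "real a - real k \<le> \<rho> * (real b - real k)"
        using assms mult_right_mono[of \<rho> 1 "real k"] by (simp add: algebra_simps)
    qed (use True assms in auto)
    also have "\<dots> = \<rho> ^ Suc k * (real (Suc k) * real (b choose Suc k))"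
      using step[of b] True ab by simp
    finally have "real (Suc k) * real (a choose Suc k) \<le> real (Suc k) * (\<rho> ^ Suc k * real (b choose Suc k))"
      by (simp add: algebra_simps)
    then show ?thesis
      by (simp only: mult_le_cancel_left_pos of_nat_0_less_iff zero_less_Suc)
  next
    case False
    then show ?thesis using assms by (simp add: binomial_eq_0)
  qed
qed auto

text \<open>The sample space of \<open>choice_pmf\<close> when \<open>N\<close> is
  \<open>nbrs n E\<close>, with the same default \<open>{}\<close>. Leaving \<open>N\<close> free
  also covers later choices, made after earlier ones are removed from the neighbourhoods.\<close>

definition cfg :: "nat \<Rightarrow> (nat \<Rightarrow> nat set) \<Rightarrow> nat \<Rightarrow> (nat \<Rightarrow> nat set) set" where
  "cfg n N k = PiE_dflt {0..<n} {} (\<lambda>v. {S. S \<subseteq> N v \<and> card S = k})"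

lemma cfgD:
  assumes "c \<in> cfg n N k"
  shows "v < n \<Longrightarrow> c v \<subseteq> N v" "v < n \<Longrightarrow> card (c v) = k" "\<not> v < n \<Longrightarrow> c v = {}"
  using assms by (auto simp: cfg_def PiE_dflt_def)

lemma cfgI:
  assumes "\<And>v. v < n \<Longrightarrow> c v \<subseteq> N v" "\<And>v. v < n \<Longrightarrow> card (c v) = k" "\<And>v. \<not> v < n \<Longrightarrow> c v = {}"
  shows "c \<in> cfg n N k"
  using assms by (auto simp: cfg_def PiE_dflt_def)

lemma finite_cfg:
  assumes "\<And>v. v < n \<Longrightarrow> finite (N v)"
  shows "finite (cfg n N k)"
  unfolding cfg_def by (rule finite_PiE_dflt) (use assms in auto)

lemma card_cfg:
  assumes "\<And>v. v < n \<Longrightarrow> finite (N v)"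
  shows "card (cfg n N k) = (\<Prod>v<n. card (N v) choose k)"
  unfolding cfg_def using assms 
  by (subst card_PiE_dflt) (auto simp: n_subsets atLeast0LessThan intro!: prod.cong)

text \<open>Each constraint concerns one vertex, so the restricted set is again a product, in which
  every vertex of \<open>X\<close> costs a factor \<open>t\<close>.\<close>

lemma card_cfg_restrict:
  fixes t :: real
  assumes fin: "\<And>v. v < n \<Longrightarrow> finite (N v)"
    and X: "X \<subseteq> {..<n}" and t: "0 \<le> t"
    and P: "\<And>v. v \<in> X \<Longrightarrow> real (card {S. S \<subseteq> N v \<and> card S = k \<and> P v S}) \<le> t * real (card (N v) choose k)"
  shows "real (card {c \<in> cfg n N k. \<forall>v\<in>X. P v (c v)}) \<le> t ^ card X * real (card (cfg n N k))"
proof -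
  let ?Q = "\<lambda>v. {S. S \<subseteq> N v \<and> card S = k \<and> (v \<in> X \<longrightarrow> P v S)}"
  have "{c \<in> cfg n N k. \<forall>v\<in>X. P v (c v)} = PiE_dflt {0..<n} {} ?Q"
    using X by (fastforce simp: cfg_def PiE_dflt_def)
  moreover have "card (PiE_dflt {0..<n} {} ?Q) = (\<Prod>v\<in>{0..<n}. card (?Q v))"
    by (rule card_PiE_dflt) (use fin in auto)
  ultimately have "real (card {c \<in> cfg n N k. \<forall>v\<in>X. P v (c v)}) = (\<Prod>v<n. real (card (?Q v)))"
    by (simp add: atLeast0LessThan)
  also have "\<dots> \<le> (\<Prod>v<n. (if v \<in> X then t else 1) * real (card (N v) choose k))"
  proof (rule prod_mono, safe)
    fix v assume "v < n"
    then show "real (card (?Q v)) \<le> (if v \<in> X then t else 1) * real (card (N v) choose k)"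
      using P[of v] fin[of v] by (auto simp: n_subsets)
  qed simp
  also have "\<dots> = t ^ card X * real (card (cfg n N k))"
  proof -
    have "{x. x < n \<and> x \<in> X} = X" "{..<n} \<inter> X = X" using X by auto
    then show ?thesis
      by (simp add: card_cfg[OF fin] prod.distrib prod.If_cases)
  qed
  finally show ?thesis .
qed

lemma card_cfg_avoid:
  fixes \<rho> :: real
  assumes fin: "\<And>v. v < n \<Longrightarrow> finite (N v)"
    and X: "X \<subseteq> {..<n}" and \<rho>: "0 \<le> \<rho>" "\<rho> \<le> 1"
    and U: "\<And>v. v \<in> X \<Longrightarrow> real (card (N v - U v)) \<le> \<rho> * real (card (N v))"
  shows "real (card {c \<in> cfg n N k. \<forall>v\<in>X. c v \<inter> U v = {}}) \<le> (\<rho> ^ k) ^ card X * real (card (cfg n N k))"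
proof (rule card_cfg_restrict[OF fin X])
  fix v assume v: "v \<in> X"
  have "{S. S \<subseteq> N v \<and> card S = k \<and> S \<inter> U v = {}} = {S. S \<subseteq> N v - U v \<and> card S = k}"
    by auto
  moreover have "finite (N v - U v)"
    using fin X v by auto
  ultimately have "card {S. S \<subseteq> N v \<and> card S = k \<and> S \<inter> U v = {}} = (card (N v - U v) choose k)"
    by (simp add: n_subsets)
  then show "real (card {S. S \<subseteq> N v \<and> card S = k \<and> S \<inter> U v = {}}) \<le> \<rho> ^ k * real (card (N v) choose k)"
    using choose_le_power_mult[OF U[OF v] \<rho>] by simp
qed (use \<rho> in auto)

text \<open>Union bound over the j-subsets of \<open>N \<inter> W\<close> that \<open>S\<close> may
  contain. The factor \<open>2 ^ k\<close> bounds the (k choose j) that \<open>choose_mult\<close>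
  leaves over.\<close>

lemma card_subsets_concentrated:
  fixes \<rho> :: real
  assumes "finite N" "real (card W) \<le> \<rho> * real (card N)" "0 \<le> \<rho>" "\<rho> \<le> 1" "finite W" "j \<le> k" "k \<le> card N"
  shows "real (card {S. S \<subseteq> N \<and> card S = k \<and> j \<le> card (S \<inter> W)}) \<le> 2 ^ k * \<rho> ^ j * real (card N choose k)"
proof -
  let ?I = "{A. A \<subseteq> N \<inter> W \<and> card A = j}"
  let ?B = "\<lambda>A. (\<lambda>B. A \<union> B) ` {B. B \<subseteq> N - A \<and> card B = k - j}"
  have finI: "finite ?I" using assms by auto
  have sub: "{S. S \<subseteq> N \<and> card S = k \<and> j \<le> card (S \<inter> W)} \<subseteq> (\<Union>A\<in>?I. ?B A)"
  proof safe
    fix S assume S: "S \<subseteq> N" "j \<le> card (S \<inter> W)" "k = card S"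
    obtain A where A: "A \<subseteq> S \<inter> W" "card A = j"
      using obtain_subset_with_card_n[OF S(2)] by metis
    have "finite S" using S assms finite_subset by auto
    then have "card (S - A) = card S - j"
      using A by (subst card_Diff_subset) (auto intro: finite_subset)
    moreover have "S = A \<union> (S - A)" using A by auto
    ultimately show "S \<in> (\<Union>A\<in>{A. A \<subseteq> N \<inter> W \<and> card A = j}. (\<union>) A ` {B. B \<subseteq> N - A \<and> card B = card S - j})"
      using A S by blast
  qed
  have cB: "card (?B A) \<le> (card N - j choose (k - j))" if "A \<in> ?I" for A
  proof -
    have "card (?B A) \<le> card {B. B \<subseteq> N - A \<and> card B = k - j}"
      by (rule card_image_le) (use assms in auto)
    also have "\<dots> = (card N - j choose (k - j))"
      using that assms by (subst n_subsets) (auto simp: card_Diff_subset finite_subset)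
    finally show ?thesis .
  qed
  have "card {S. S \<subseteq> N \<and> card S = k \<and> j \<le> card (S \<inter> W)} \<le> card (\<Union>A\<in>?I. ?B A)"
    by (rule card_mono[OF _ sub]) (use assms in auto)
  also have "\<dots> \<le> (\<Sum>A\<in>?I. card (?B A))"
    by (rule card_UN_le[OF finI])
  also have "\<dots> \<le> (\<Sum>A\<in>?I. (card N - j choose (k - j)))"
    by (rule sum_mono[OF cB])
  also have "\<dots> = (card (N \<inter> W) choose j) * (card N - j choose (k - j))"
    using assms n_subsets[of "N \<inter> W" j] by (simp del: Int_subset_iff le_inf_iff)
  finally have "real (card {S. S \<subseteq> N \<and> card S = k \<and> j \<le> card (S \<inter> W)})
     \<le> real ((card (N \<inter> W) choose j) * (card N - j choose (k - j)))"
    by (simp only: of_nat_le_iff)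
  also have "\<dots> = real (card (N \<inter> W) choose j) * real (card N - j choose (k - j))"
    by simp
  also have "\<dots> \<le> (\<rho> ^ j * real (card N choose j)) * real (card N - j choose (k - j))"
  proof (intro mult_right_mono choose_le_power_mult)
    show "real (card (N \<inter> W)) \<le> \<rho> * real (card N)"
      using assms card_mono[of W "N \<inter> W"] by simp
  qed (use assms in auto)
  also have "\<dots> = \<rho> ^ j * real ((card N choose k) * (k choose j))"
    using choose_mult[of j k "card N"] assms by simp
  also have "\<dots> \<le> \<rho> ^ j * (real (card N choose k) * 2 ^ k)"
  proof -
    have "(k choose j) \<le> 2 ^ k" using binomial_le_pow2 .
    then have "real (k choose j) \<le> 2 ^ k"
      by (metis of_nat_le_iff of_nat_numeral of_nat_power)
    then show ?thesis using assms by (auto intro!: mult_left_mono)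
  qed
  finally show ?thesis by (simp add: mult_ac)
qed

section \<open>Splitting configurations into successive choices\<close>

text \<open>Padding \<open>F\<close> to exactly \<open>r\<close> elements inside \<open>C\<close>
  can only lose supersets, and makes the bound independent of the size of \<open>F\<close>.\<close>

lemma card_supersets_ge:
  assumes "finite C" "card C = k" "F \<subseteq> C" "card F \<le> r" "r \<le> j" "j \<le> k"
  shows "(k - r choose (j - r)) \<le> card {A. F \<subseteq> A \<and> A \<subseteq> C \<and> card A = j}"
proof -
  obtain F' where F': "F \<subseteq> F'" "F' \<subseteq> C" "card F' = r"
  proof -
    have "finite F" using assms finite_subset by auto
    have "r - card F \<le> card (C - F)"
      using assms \<open>finite F\<close> by (simp add: card_Diff_subset)
    then obtain D where D: "D \<subseteq> C - F" "card D = r - card F"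
      by (metis obtain_subset_with_card_n)
    have "card (F \<union> D) = r"
      using D assms \<open>finite F\<close> by (subst card_Un_disjoint) (auto intro: finite_subset)
    then show ?thesis using D assms by (intro that[of "F \<union> D"]) auto
  qed
  have finF: "finite F'" using F' assms finite_subset by auto
  have "(k - r choose (j - r)) = card {B. B \<subseteq> C - F' \<and> card B = j - r}"
    using assms F' finF by (subst n_subsets) (auto simp: card_Diff_subset)
  also have "\<dots> \<le> card {A. F \<subseteq> A \<and> A \<subseteq> C \<and> card A = j}"
  proof (rule card_inj_on_le)
    show "inj_on (\<lambda>B. F' \<union> B) {B. B \<subseteq> C - F' \<and> card B = j - r}"
      by (rule inj_onI) auto
    show "(\<lambda>B. F' \<union> B) ` {B. B \<subseteq> C - F' \<and> card B = j - r} \<subseteq> {A. F \<subseteq> A \<and> A \<subseteq> C \<and> card A = j}"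
    proof safe
      fix B assume B: "B \<subseteq> C - F'" "card B = j - r"
      have "finite B" using B assms finite_subset by blast
      then show "card (F' \<union> B) = j"
        using B F' finF assms by (subst card_Un_disjoint) auto
    qed (use F' in auto)
    show "finite {A. F \<subseteq> A \<and> A \<subseteq> C \<and> card A = j}"
      using assms by auto
  qed
  finally show ?thesis .
qed

text \<open>The second factor on the left bounds from below the number of ways of splitting one
  configuration so that \<open>F\<close> falls into the first part. With \<open>card_cfg_mult\<close>, it turns a bound for
  split configurations into one for configurations, at the price of an exponential factor that
  does not depend on \<open>k\<close>.\<close>

lemma card_cfg_split:
  assumes fin: "\<And>v. v < n \<Longrightarrow> finite (N v)"
    and X: "X \<subseteq> cfg n N k" and r: "r \<le> j" "j \<le> k"
    and F: "\<And>c v. c \<in> X \<Longrightarrow> v < n \<Longrightarrow> F c v \<subseteq> c v" "\<And>c v. c \<in> X \<Longrightarrow> v < n \<Longrightarrow> card (F c v) \<le> r"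
  shows "card X * (k - r choose (j - r)) ^ n \<le>
     card (SIGMA a:cfg n N j. {e \<in> cfg n (\<lambda>v. N v - a v) (k - j).
        (\<lambda>v. a v \<union> e v) \<in> X \<and> (\<forall>v<n. F (\<lambda>v. a v \<union> e v) v \<subseteq> a v)})" (is "_ \<le> card ?R")
proof -
  let ?S = "\<lambda>c. PiE_dflt {0..<n} {} (\<lambda>v. {A. F c v \<subseteq> A \<and> A \<subseteq> c v \<and> card A = j})"
  have finc: "finite (c v)" if "c \<in> X" "v < n" for c v
    using that X fin cfgD(1) finite_subset by (metis subsetD)
  have finX: "finite X" by (rule finite_subset[OF X finite_cfg[OF fin]])
  have finS: "finite (?S c)" if "c \<in> X" for c
    by (rule finite_PiE_dflt) (use that finc in auto)
  have "card X * (k - r choose (j - r)) ^ n = (\<Sum>c\<in>X. (\<Prod>v<n. (k - r choose (j - r))))"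
    by simp
  also have "\<dots> \<le> (\<Sum>c\<in>X. card (?S c))"
  proof (rule sum_mono)
    fix c assume c: "c \<in> X"
    have "(\<Prod>v<n. (k - r choose (j - r))) \<le> (\<Prod>v<n. card {A. F c v \<subseteq> A \<and> A \<subseteq> c v \<and> card A = j})"
      using c F r X finc by (intro prod_mono conjI card_supersets_ge) (auto dest: cfgD)
    also have "\<dots> = card (?S c)"
      using finc[OF c] by (subst card_PiE_dflt) (auto simp: atLeast0LessThan)
    finally show "(\<Prod>v<n. (k - r choose (j - r))) \<le> card (?S c)" .
  qed
  also have "\<dots> = card (SIGMA c:X. ?S c)"
    using finX finS by (simp add: card_SigmaI)
  also have "\<dots> \<le> card ?R"
  proof (rule card_inj_on_le)
    \<comment> \<open>The pair is recorded as the kept part and the rest; their union gives back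
      \<open>c\<close>, hence injectivity.\<close>
    let ?f = "\<lambda>(c, a). (a, \<lambda>v. c v - a v :: nat set)"
    have un: "(\<lambda>v. a v \<union> (c v - a v)) = c" if "c \<in> X" "a \<in> ?S c" for c a
    proof
      fix v show "a v \<union> (c v - a v) = c v"
        using that by (cases "v < n") (auto simp: PiE_dflt_def)
    qed
    show "inj_on ?f (SIGMA c:X. ?S c)"
    proof (rule inj_onI, clarify)
      fix c a c' a'
      assume *: "c \<in> X" "a \<in> ?S c" "c' \<in> X" "a \<in> ?S c'" "(\<lambda>v. c v - a v) = (\<lambda>v. c' v - a v)"
      have "c = (\<lambda>v. a v \<union> (c v - a v))" by (rule un[OF *(1,2), symmetric])
      also have "\<dots> = (\<lambda>v. a v \<union> (c' v - a v))"
        using fun_cong[OF *(5)] by simp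
      also have "\<dots> = c'" by (rule un[OF *(3,4)])
      finally show "c = c' \<and> a = a" by simp
    qed
    show "?f ` (SIGMA c:X. ?S c) \<subseteq> ?R"
    proof (rule image_subsetI)
      fix z assume "z \<in> (SIGMA c:X. ?S c)"
      then obtain c a where z: "z = (c, a)" and *: "c \<in> X" "a \<in> ?S c"
        by blast
      have cc: "c \<in> cfg n N k" using * X by auto
      have a: "F c v \<subseteq> a v" "a v \<subseteq> c v" "card (a v) = j" if "v < n" for v
        using * that by (auto simp: PiE_dflt_def)
      have a0: "a v = {}" if "\<not> v < n" for v
        using * that by (auto simp: PiE_dflt_def)
      have "a \<in> cfg n N j"
        using a(3) a0 subset_trans[OF a(2) cfgD(1)[OF cc]] by (intro cfgI)
      moreover have "(\<lambda>v. c v - a v) \<in> cfg n (\<lambda>v. N v - a v) (k - j)"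
      proof (intro cfgI)
        fix v assume v: "v < n"
        show "c v - a v \<subseteq> N v - a v" using cfgD(1)[OF cc v] by auto
        show "card (c v - a v) = k - j"
          using card_Diff_subset[OF finite_subset[OF a(2)[OF v] finc[OF *(1) v]] a(2)[OF v]]
            a(3)[OF v] cfgD(2)[OF cc v] by simp
      qed (use cfgD(3)[OF cc] in auto)
      moreover have "(\<lambda>v. a v \<union> (c v - a v)) \<in> X"
        using un[OF *] *(1) by simp
      moreover have "\<forall>v<n. F (\<lambda>v. a v \<union> (c v - a v)) v \<subseteq> a v"
        using un[OF *] a by simp
      ultimately show "?f z \<in> ?R"
        by (simp add: z)
    qed
    show "finite ?R"
      using fin by (intro finite_SigmaI finite_cfg) (auto intro!: finite_subset[OF _ finite_cfg])
  qed
  finally show ?thesis .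
qed

text \<open>Every first-stage \<open>a\<close> leaves the same number of second-stage
  configurations, so the fibres of a splitting are equally large.\<close>

lemma card_cfg_Diff:
  assumes fin: "\<And>v. v < n \<Longrightarrow> finite (N v)" and a: "a \<in> cfg n N j"
  shows "card (cfg n (\<lambda>v. N v - a v) m) = (\<Prod>v<n. card (N v) - j choose m)"
proof -
  have "card (N v - a v) = card (N v) - j" if "v < n" for v
    using cfgD[OF a] fin that by (metis card_Diff_subset finite_subset)
  then show ?thesis
    using fin by (simp add: card_cfg)
qed

text \<open>Double count at each vertex: choose j elements and then k - j more, or choose all k and
  then the j that come first.\<close>

lemma card_cfg_mult:
  assumes fin: "\<And>v. v < n \<Longrightarrow> finite (N v)" and "j \<le> k" "\<And>v. v < n \<Longrightarrow> k \<le> card (N v)"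
  shows "card (cfg n N j) * (\<Prod>v<n. card (N v) - j choose (k - j)) = card (cfg n N k) * (k choose j) ^ n"
proof -
  have "(k choose j) ^ n = (\<Prod>v<n. (k choose j))" by simp
  moreover have "(\<Prod>v<n. (card (N v) choose j) * (card (N v) - j choose (k - j))) =
      (\<Prod>v<n. (card (N v) choose k) * (k choose j))"
    using assms(2,3) by (intro prod.cong) (auto simp: choose_mult)
  ultimately show ?thesis
    by (simp only: card_cfg[OF fin] prod.distrib)
qed

section \<open>Longest paths and rotations\<close>

definition path_in :: "'a set \<Rightarrow> ('a \<Rightarrow> 'a \<Rightarrow> bool) \<Rightarrow> 'a list \<Rightarrow> bool" where
  "path_in V H p \<longleftrightarrow> p \<noteq> [] \<and> distinct p \<and> set p \<subseteq> V \<and> successively H p"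

definition longest_path :: "'a set \<Rightarrow> ('a \<Rightarrow> 'a \<Rightarrow> bool) \<Rightarrow> 'a list \<Rightarrow> bool" where
  "longest_path V H p \<longleftrightarrow> path_in V H p \<and> (\<forall>q. path_in V H q \<longrightarrow> length q \<le> length p)"

definition ends :: "'a set \<Rightarrow> ('a \<Rightarrow> 'a \<Rightarrow> bool) \<Rightarrow> 'a \<Rightarrow> 'a set" where
  "ends V H x = {last q |q. longest_path V H q \<and> hd q = x}"

definition starts :: "'a set \<Rightarrow> ('a \<Rightarrow> 'a \<Rightarrow> bool) \<Rightarrow> 'a set" where
  "starts V H = {hd q |q. longest_path V H q}"

text \<open>This is adjacency along \<open>p\<close> in either order. The form with
  \<open>successively\<close> lets the rules for append and reversal apply directly.\<close>

definition path_adj :: "'a list \<Rightarrow> 'a \<Rightarrow> 'a \<Rightarrow> bool" where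
  "path_adj p u w \<longleftrightarrow> \<not> successively (\<lambda>x y. {x, y} \<noteq> {u, w}) p"

lemma path_adj_append:
  "path_adj (xs @ ys) u w \<longleftrightarrow>
     path_adj xs u w \<or> path_adj ys u w \<or> xs \<noteq> [] \<and> ys \<noteq> [] \<and> {last xs, hd ys} = {u, w}"
  by (auto simp: path_adj_def successively_append_iff)

lemma path_adj_rev: "path_adj (rev xs) u w \<longleftrightarrow> path_adj xs u w"
  by (simp add: path_adj_def insert_commute)

lemma path_adj_commute: "path_adj xs u w \<longleftrightarrow> path_adj xs w u"
  by (simp add: path_adj_def insert_commute)

lemma path_adj_in_set: "path_adj xs u w \<Longrightarrow> u \<in> set xs"
proof (rule ccontr)
  assume "path_adj xs u w" "u \<notin> set xs"
  moreover have "successively (\<lambda>x y. {x, y} \<noteq> {u, w}) xs"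
    using \<open>u \<notin> set xs\<close> by (induction xs rule: induct_list012) auto
  ultimately show False by (simp add: path_adj_def)
qed

lemma path_adj_nth: "Suc i < length p \<Longrightarrow> path_adj p (p ! i) (p ! Suc i)"
  by (auto simp: path_adj_def successively_conv_nth)

lemma path_adj_neighbours:
  assumes "distinct p"
  obtains a b where "{w. path_adj p u w} \<subseteq> {a, b}"
proof (cases "u \<in> set p")
  case False
  then show ?thesis using that path_adj_in_set by fastforce
next
  case True
  then obtain xs ys where p: "p = xs @ u # ys"
    by (meson split_list)
  have u: "u \<notin> set xs" "u \<notin> set ys"
    using assms p by auto
  \<comment> \<open>If u is an end of the path, one of these values is arbitrary, which an inclusion
    tolerates.\<close>
  have "{w. path_adj p u w} \<subseteq> {last xs, hd ys}"
  proof
    fix w assume "w \<in> {w. path_adj p u w}"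
    then have "path_adj xs u w \<or> path_adj ([u] @ ys) u w \<or> xs \<noteq> [] \<and> {last xs, u} = {u, w}"
      by (simp add: p path_adj_append)
    then have "path_adj ([u] @ ys) u w \<or> xs \<noteq> [] \<and> {last xs, u} = {u, w}"
      using path_adj_in_set u by metis
    moreover have "w = hd ys" if "path_adj ([u] @ ys) u w"
    proof -
      have "\<not> path_adj [u] u w" by (simp add: path_adj_def)
      moreover have "\<not> path_adj ys u w" using path_adj_in_set u by metis
      ultimately show ?thesis
        using that unfolding path_adj_append by (auto simp: doubleton_eq_iff)
    qed
    ultimately show "w \<in> {last xs, hd ys}"
      by (auto simp: doubleton_eq_iff)
  qed
  then show ?thesis using that by blast
qed

lemma card_path_adj:
  assumes "distinct p"
  shows "finite {w. path_adj p u w}" "card {w. path_adj p u w} \<le> 2"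
proof -
  obtain a b where ab: "{w. path_adj p u w} \<subseteq> {a, b}"
    using path_adj_neighbours[OF assms] .
  then show "finite {w. path_adj p u w}"
    by (rule finite_subset) simp
  show "card {w. path_adj p u w} \<le> 2"
    using card_mono[OF _ ab] card_insert_le_m1[of 2 "{b}" a] by simp
qed

lemma longest_path_exists:
  assumes "finite V" "V \<noteq> {}"
  obtains p where "longest_path V H p"
proof -
  obtain v where "v \<in> V" using assms by auto
  then have "path_in V H [v]" by (auto simp: path_in_def)
  moreover have "\<forall>q. path_in V H q \<longrightarrow> length q \<le> card V"
    using assms by (metis card_mono distinct_card path_in_def)
  ultimately obtain p where "path_in V H p" "\<forall>q. path_in V H q \<longrightarrow> length q \<le> length p"
    using ex_has_greatest_nat[of "path_in V H" "[v]" length "Suc (card V)"] by (auto simp: less_Suc_eq_le)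
  then show ?thesis using that by (auto simp: longest_path_def)
qed

lemma longest_path_same_length:
  assumes "longest_path V H p" "path_in V H q" "length q = length p"
  shows "longest_path V H q"
  using assms by (auto simp: longest_path_def)

lemma successively_flip:
  assumes "symp H"
  shows "successively (\<lambda>x y. H y x) xs \<longleftrightarrow> successively H xs"
proof -
  have "(\<lambda>x y. H y x) = H" using assms by (auto simp: fun_eq_iff symp_def)
  then show ?thesis by (rule arg_cong)
qed

lemma longest_path_rev:
  assumes "symp H" "longest_path V H p"
  shows "longest_path V H (rev p)"
  using assms(2) by (auto simp: longest_path_def path_in_def successively_flip[OF assms(1)])

lemma ends_subset_starts:
  assumes "symp H"
  shows "ends V H x \<subseteq> starts V H"
proof
  fix y assume "y \<in> ends V H x"
  then obtain q where "longest_path V H q" "y = last q" by (auto simp: ends_def)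
  then have "longest_path V H (rev q)" "y = hd (rev q)"
    using longest_path_rev[OF assms] by (auto simp: hd_rev longest_path_def path_in_def)
  then show "y \<in> starts V H" by (auto simp: starts_def)
qed

section \<open>Rotations and Posa's lemma\<close>

lemma path_in_rotate:
  assumes "symp H" "path_in V H (us @ w # vs)" "vs \<noteq> []" "H (last vs) w"
  shows "path_in V H (us @ w # rev vs)"
proof -
  have "H w (last vs)" using assms(1,4) by (auto simp: symp_def)
  then show ?thesis
    using assms(2,3) by (auto simp: path_in_def successively_append_iff successively_Cons hd_rev
        successively_flip[OF assms(1)])
qed

lemma longest_path_neighbour_on_path:
  assumes "longest_path V H p" "H (last p) w" "w \<in> V"
  shows "w \<in> set p"
proof (rule ccontr)
  assume "w \<notin> set p"
  then have "path_in V H (p @ [w])"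
    using assms by (auto simp: longest_path_def path_in_def successively_append_iff)
  then show False using assms(1) by (auto simp: longest_path_def)
qed

text \<open>The rotation adds the edge from \<open>last q\<close> to \<open>q ! i\<close>, drops the
  edge from \<open>q ! i\<close> to its successor and reverses the tail. The successor becomes the
  end; the start is kept.\<close>

lemma ends_rotate:
  assumes "symp H" "longest_path V H q" "H (last q) (q ! i)" "Suc i < length q"
  shows "q ! Suc i \<in> ends V H (hd q)"
proof -
  have q: "q = take i q @ q ! i # drop (Suc i) q" "drop (Suc i) q \<noteq> []"
    using assms(4) id_take_nth_drop[of i q] by auto
  let ?q = "take i q @ q ! i # rev (drop (Suc i) q)"
  have "path_in V H ?q"
    using assms q by (intro path_in_rotate) (auto simp: longest_path_def)
  moreover have "length ?q = length q"
    using assms(4) by simp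
  ultimately have "longest_path V H ?q"
    using assms(2) longest_path_same_length by blast
  moreover have "hd ?q = hd q"
    using assms(4) by (cases i; cases q) auto
  moreover have "last ?q = q ! Suc i"
    using q(2) by (simp add: last_rev hd_drop_conv_nth)
  ultimately show ?thesis by (force simp: ends_def)
qed

text \<open>If the endpoint of a longest path \<open>q\<close> is adjacent to a vertex of \<open>preds V q W\<close>, then the path
  extends, or one rotation moves its endpoint into \<open>W\<close>.\<close>

definition preds :: "'a set \<Rightarrow> 'a list \<Rightarrow> 'a set \<Rightarrow> 'a set" where
  "preds V q W = (V - set q) \<union> {q ! i |i. Suc i < length q \<and> q ! Suc i \<in> W}"

text \<open>By maximality a neighbour of the endpoint lies on \<open>q\<close>, and by rotation its
  successor on \<open>q\<close>, if any, is an endpoint too.\<close>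

lemma preds_avoid_neighbours:
  assumes "symp H" "longest_path V H q" "H (last q) w" "w \<in> V"
  shows "w \<notin> preds V q (V - ends V H (hd q))"
  using longest_path_neighbour_on_path[OF assms(2-4)] ends_rotate[OF assms(1,2)] assms(3)
  by (auto simp: preds_def)

text \<open>Vertices of \<open>W\<close> off the path count themselves, those on it count their
  predecessors. Only the head has none, which costs one.\<close>

lemma card_preds:
  assumes "finite V" "W \<subseteq> V" "distinct q" "q \<noteq> []"
  shows "card W \<le> Suc (card (preds V q W))"
proof -
  let ?I = "{i. Suc i < length q \<and> q ! Suc i \<in> W}"
  have finI: "finite ?I" by (rule finite_subset[of _ "{..<length q}"]) auto
  have inj: "inj_on ((!) q) ?I"
    using assms(3) by (auto simp: inj_on_def nth_eq_iff_index_eq)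
  have "W \<subseteq> insert (hd q) ((V - set q) \<union> (\<lambda>i. q ! Suc i) ` ?I)"
  proof
    fix w assume w: "w \<in> W"
    show "w \<in> insert (hd q) ((V - set q) \<union> (\<lambda>i. q ! Suc i) ` ?I)"
    proof (cases "w \<in> set q")
      case True
      then obtain j where j: "j < length q" "q ! j = w" by (auto simp: in_set_conv_nth)
      show ?thesis
      proof (cases j)
        case 0
        then show ?thesis using j assms(4) by (simp add: hd_conv_nth)
      next
        case (Suc i)
        then show ?thesis using j w by auto
      qed
    qed (use w assms in auto)
  qed
  then have "card W \<le> card (insert (hd q) ((V - set q) \<union> (\<lambda>i. q ! Suc i) ` ?I))"
    using assms(1) finI by (intro card_mono) auto
  also have "\<dots> \<le> Suc (card ((V - set q) \<union> (\<lambda>i. q ! Suc i) ` ?I))"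
    by (rule card_insert_le_m1) auto
  also have "\<dots> \<le> Suc (card (V - set q) + card ?I)"
    using card_Un_le[of "V - set q" "(\<lambda>i. q ! Suc i) ` ?I"] card_image_le[OF finI, of "\<lambda>i. q ! Suc i"] by linarith
  also have "card (V - set q) + card ?I = card ((V - set q) \<union> (!) q ` ?I)"
    using inj finI assms(1) by (subst card_Un_disjoint) (auto simp: card_image)
  also have "(V - set q) \<union> (!) q ` ?I = preds V q W"
    by (auto simp: preds_def)
  finally show ?thesis .
qed

text \<open>Only paths obtained by rotations are collected, rather than all longest paths with the
  same start, because Posa's argument follows which edges of the initial path survive.\<close>

inductive_set rotations :: "('a \<Rightarrow> 'a \<Rightarrow> bool) \<Rightarrow> 'a list \<Rightarrow> 'a list set"
  for H p\<^sub>0 where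
  base: "p\<^sub>0 \<in> rotations H p\<^sub>0"
| rotate: "us @ w # vs \<in> rotations H p\<^sub>0 \<Longrightarrow> vs \<noteq> [] \<Longrightarrow> H (last vs) w \<Longrightarrow>
    us @ w # rev vs \<in> rotations H p\<^sub>0"

lemma rotations_longest_path:
  assumes "symp H" "longest_path V H p\<^sub>0" "p \<in> rotations H p\<^sub>0"
  shows "longest_path V H p \<and> hd p = hd p\<^sub>0"
  using assms(3)
proof induction
  case (rotate us w vs)
  have "path_in V H (us @ w # rev vs)"
    using rotate assms(1) by (intro path_in_rotate) (auto simp: longest_path_def)
  then have "longest_path V H (us @ w # rev vs)"
    by (rule longest_path_same_length[of V H "us @ w # vs", rotated]) (use rotate in auto)
  moreover have "hd (us @ w # rev vs) = hd p\<^sub>0"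
    using rotate by (cases us) auto
  ultimately show ?case by blast
qed (use assms in simp)

text \<open>A vertex can only lose a path edge by a rotation that makes the other end of that edge
  an endpoint.\<close>

lemma rotations_path_adj:
  assumes w: "w \<notin> last ` rotations H p\<^sub>0" "\<And>r. r \<in> last ` rotations H p\<^sub>0 \<Longrightarrow> \<not> path_adj p\<^sub>0 r w"
    and "p \<in> rotations H p\<^sub>0" "path_adj p u w"
  shows "path_adj p\<^sub>0 u w"
  using assms(3,4)
proof (induction arbitrary: u)
  case (rotate us x vs)
  have new: "us @ x # rev vs \<in> rotations H p\<^sub>0"
    using rotate by (intro rotations.rotate)
  \<comment> \<open>The rotation trades the edge between \<open>x\<close> and \<open>hd vs\<close>
    for one between \<open>x\<close> and \<open>last vs\<close>. By the induction hypothesis for the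
    old edge \<open>w\<close> is not \<open>x\<close>, and it is not the endpoint
    \<open>last vs\<close>; so the new edge does not touch \<open>w\<close>.\<close>
  have "hd vs \<in> last ` rotations H p\<^sub>0"
    using rotate(2) by (intro image_eqI[OF _ new]) (simp add: last_rev)
  moreover have last: "last vs \<in> last ` rotations H p\<^sub>0"
    using rotate(2) by (intro image_eqI[OF _ rotate(1)]) simp
  moreover have old: "path_adj ((us @ [x]) @ vs) (hd vs) x"
    using rotate(2) unfolding path_adj_append[of "us @ [x]"] by auto
  ultimately have "w \<noteq> x" "w \<noteq> last vs"
    using w rotate(4)[of "hd vs"] by auto
  moreover have "path_adj ((us @ [x]) @ rev vs) u w"
    using rotate by simp
  ultimately have "path_adj ((us @ [x]) @ vs) u w"
    using rotate(2) unfolding path_adj_append[of "us @ [x]"]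
    by (auto simp: path_adj_rev hd_rev doubleton_eq_iff)
  then show ?case using rotate(4) by simp
qed

text \<open>A neighbour w of an endpoint r lies on the rotated path ending in r, and rotating at w
  makes the vertex after w an endpoint. If w itself is none, \<open>rotations_path_adj\<close>
  yields, by contradiction, that w is adjacent on the initial path to a member of \<open>R\<close>.
  Each member has at most two such neighbours.\<close>

lemma posa:
  assumes "symp H" "longest_path V H p\<^sub>0" "finite V"
  defines "R \<equiv> last ` rotations H p\<^sub>0"
  shows "card (R \<union> {w \<in> V. \<exists>r\<in>R. H r w}) \<le> 3 * card R"
proof -
  have lp: "longest_path V H p" if "p \<in> rotations H p\<^sub>0" for p
    using rotations_longest_path[OF assms(1,2) that] by blast
  have "R \<subseteq> V"
    using lp by (fastforce simp: R_def longest_path_def path_in_def)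
  then have finR: "finite R" using assms(3) finite_subset by blast
  have dist: "distinct p\<^sub>0" using assms(2) by (auto simp: longest_path_def path_in_def)
  have "R \<union> {w \<in> V. \<exists>r\<in>R. H r w} \<subseteq> R \<union> (\<Union>r\<in>R. {w. path_adj p\<^sub>0 r w})"
  proof -
    have "\<exists>r'\<in>R. path_adj p\<^sub>0 r' w" if *: "w \<in> V" "r \<in> R" "H r w" "w \<notin> R" for w r
    proof (rule ccontr)
      assume neg: "\<not> (\<exists>r'\<in>R. path_adj p\<^sub>0 r' w)"
      obtain p where p: "p \<in> rotations H p\<^sub>0" "r = last p"
        using *(2) by (auto simp: R_def)
      have "w \<in> set p"
        using longest_path_neighbour_on_path[OF lp[OF p(1)]] * p by auto
      then obtain us vs where us: "p = us @ w # vs" by (meson split_list)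
      have vs: "vs \<noteq> []"
      proof
        assume "vs = []"
        then have "w = last p" using us by simp
        then show False using p * by (auto simp: R_def)
      qed
      have "us @ w # rev vs \<in> rotations H p\<^sub>0"
        using p us vs *(3) by (intro rotations.rotate) auto
      then have "hd vs \<in> R"
        unfolding R_def by (rule image_eqI[rotated]) (use vs in \<open>simp add: last_rev\<close>)
      moreover have "path_adj ((us @ [w]) @ vs) (hd vs) w"
        using vs unfolding path_adj_append[of "us @ [w]"] by auto
      then have "path_adj p\<^sub>0 (hd vs) w"
        using rotations_path_adj[of w H p\<^sub>0 p "hd vs"] neg *(4) p us by (auto simp: R_def)
      ultimately show False using neg by blast
    qed
    then show ?thesis by blast
  qed
  then have "card (R \<union> {w \<in> V. \<exists>r\<in>R. H r w}) \<le> card (R \<union> (\<Union>r\<in>R. {w. path_adj p\<^sub>0 r w}))"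
    using finR card_path_adj(1)[OF dist] by (intro card_mono) auto
  also have "\<dots> \<le> card R + card (\<Union>r\<in>R. {w. path_adj p\<^sub>0 r w})"
    by (rule card_Un_le)
  also have "card (\<Union>r\<in>R. {w. path_adj p\<^sub>0 r w}) \<le> (\<Sum>r\<in>R. card {w. path_adj p\<^sub>0 r w})"
    by (rule card_UN_le[OF finR])
  also have "\<dots> \<le> (\<Sum>r\<in>R. 2)"
    by (rule sum_mono) (rule card_path_adj(2)[OF dist])
  finally show ?thesis by simp
qed

section \<open>Expansion, many endpoints, and closing a path\<close>

text \<open>The exact opposite of Posa's bound: the factor 3 stands for a vertex of \<open>S\<close>
  and its two path neighbours.\<close>

definition expander :: "'a set \<Rightarrow> ('a \<Rightarrow> 'a \<Rightarrow> bool) \<Rightarrow> nat \<Rightarrow> bool" where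
  "expander V H s \<longleftrightarrow> (\<forall>S. S \<subseteq> V \<longrightarrow> S \<noteq> {} \<longrightarrow> card S \<le> s \<longrightarrow>
     3 * card S < card (S \<union> {w \<in> V. \<exists>r\<in>S. H r w}))"

lemma ends_subset: "ends V H x \<subseteq> V"
  by (fastforce simp: ends_def longest_path_def path_in_def)

lemma starts_subset: "starts V H \<subseteq> V"
  by (fastforce simp: starts_def longest_path_def path_in_def)

text \<open>By \<open>posa\<close> the endpoints reached by rotations violate the expansion
  inequality, so there are more than \<open>s\<close> of them.\<close>

lemma card_ends:
  assumes "symp H" "finite V" "expander V H s" "x \<in> starts V H"
  shows "s < card (ends V H x)"
proof -
  obtain p where p: "longest_path V H p" "hd p = x"
    using assms(4) by (auto simp: starts_def)
  let ?R = "last ` rotations H p"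
  have "?R \<subseteq> ends V H x"
    using rotations_longest_path[OF assms(1) p(1)] p(2) by (fastforce simp: ends_def)
  then have le: "card ?R \<le> card (ends V H x)" and RV: "?R \<subseteq> V"
    using ends_subset[of V H x] finite_subset[OF ends_subset assms(2)] by (simp_all add: card_mono)
  have "?R \<noteq> {}" using rotations.base[of p H] by blast
  then have "\<not> card ?R \<le> s"
    using posa[OF assms(1) p(1) assms(2)] assms(3) RV unfolding expander_def by (meson not_le)
  then show ?thesis using le by linarith
qed

text \<open>Reversal turns the endpoints belonging to a single start into starts.\<close>

lemma card_starts:
  assumes "symp H" "finite V" "expander V H s" "V \<noteq> {}"
  shows "s < card (starts V H)"
proof -
  obtain p where "longest_path V H p"
    using longest_path_exists assms by blast
  then have "hd p \<in> starts V H" by (auto simp: starts_def)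
  then have "s < card (ends V H (hd p))"
    using card_ends[OF assms(1-3)] by blast
  moreover have "finite (starts V H)" 
    using finite_subset[OF starts_subset] assms(2) by blast
  then have "card (ends V H (hd p)) \<le> card (starts V H)"
    by (rule card_mono[OF _ ends_subset_starts[OF assms(1)]])
  ultimately show ?thesis by linarith
qed

text \<open>If the cycle missed a vertex, connectivity would give an edge leaving it, and the cycle
  opened next to that edge would yield a longer path.\<close>

lemma hamiltonian_if_longest_path_closes:
  assumes "symp H" "longest_path {..<n} H p" "H (last p) (hd p)" "n \<ge> 3"
    and conn: "\<And>C. C \<noteq> {} \<Longrightarrow> C \<subset> {..<n} \<Longrightarrow> \<exists>u\<in>C. \<exists>w\<in>{..<n} - C. H u w"
  shows "hamiltonian n H"
proof -
  have p: "p \<noteq> []" "distinct p" "set p \<subseteq> {..<n}" "successively H p"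
    using assms(2) by (auto simp: longest_path_def path_in_def)
  have all: "set p = {..<n}"
  proof (rule ccontr)
    assume "set p \<noteq> {..<n}"
    then obtain u w where uw: "u \<in> set p" "w < n" "w \<notin> set p" "H u w"
      using conn[of "set p"] p by auto
    then obtain xs ys where xy: "p = xs @ u # ys" by (meson split_list)
    \<comment> \<open>The cycle is read from the vertex after u, across the closing edge from
      \<open>last p\<close> to \<open>hd p\<close>, round to u, and continued to w.\<close>
    have "successively H (ys @ xs @ [u, w])"
      using p(4) assms(3) uw(4)
      by (cases xs; cases ys) (auto simp: xy successively_append_iff successively_Cons hd_append split: if_splits)
    then have "path_in {..<n} H (ys @ xs @ [u, w])"
      using p uw by (auto simp: path_in_def xy)
    then show False
      using assms(2) by (auto simp: longest_path_def xy)
  qed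
  then have len: "length p = n"
    using p(2) distinct_card by fastforce
  have "bij_betw ((!) p) {0..<n} {0..<n}"
    using bij_betw_nth[OF p(2), of "{0..<n}" "{0..<n}"] len all by (auto simp: atLeast0LessThan)
  moreover have "H (p ! i) (p ! (Suc i mod n))" if "i < n" for i
  proof (cases "Suc i = n")
    case True
    then show ?thesis using assms(3) p(1) len by (auto simp: last_conv_nth hd_conv_nth)
  next
    case False
    then show ?thesis using that p(4) len by (auto simp: successively_conv_nth)
  qed
  ultimately show ?thesis
    using assms(4) by (auto simp: hamiltonian_def)
qed

section \<open>Blocked extensions of an expander\<close>

lemma symp_Gk_graph: "symp (Gk_graph c)"
  by (auto simp: symp_def Gk_graph_def)

text \<open>Only the edges of \<open>p\<close> have to lie in \<open>K\<close>, so this also moves a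
  path into a smaller graph.\<close>

lemma path_in_mono:
  assumes "path_in V H p" "\<And>u w. path_adj p u w \<Longrightarrow> H u w \<Longrightarrow> K u w"
  shows "path_in V K p"
  using assms path_adj_nth[of _ p] by (auto simp: path_in_def successively_conv_nth)

lemma longest_path_between:
  assumes "longest_path V K p" "path_in V H p" "\<And>u w. H u w \<Longrightarrow> K u w"
  shows "longest_path V H p"
  using assms path_in_mono[of V H _ K] by (auto simp: longest_path_def)

text \<open>The common longest path \<open>p\<close> shows that the maximal lengths agree, so
  longest paths of the smaller graph remain longest.\<close>

lemma longest_path_mono:
  assumes "longest_path V H p" "longest_path V K p" "\<And>u w. H u w \<Longrightarrow> K u w" "longest_path V H q"
  shows "longest_path V K q"
proof (rule longest_path_same_length[OF assms(2)])
  show "path_in V K q"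
    using path_in_mono[of V H q K] assms(3,4) by (auto simp: longest_path_def)
  show "length q = length p"
    using assms(1,4) by (auto simp: longest_path_def intro: antisym)
qed

lemma cfg_union:
  assumes "\<And>v. v < n \<Longrightarrow> finite (N v)" and a: "a \<in> cfg n N j" and b: "b \<in> cfg n (\<lambda>v. N v - a v) i"
  shows "(\<lambda>v. a v \<union> b v) \<in> cfg n N (j + i)"
proof (rule cfgI)
  fix v assume v: "v < n"
  show "a v \<union> b v \<subseteq> N v" using cfgD(1)[OF a v] cfgD(1)[OF b v] by auto
  have "finite (a v)" "finite (b v)" "a v \<inter> b v = {}"
    using cfgD(1)[OF a v] cfgD(1)[OF b v] assms(1)[OF v] by (auto intro: finite_subset)
  then show "card (a v \<union> b v) = j + i"
    using cfgD(2)[OF a v] cfgD(2)[OF b v] by (simp add: card_Un_disjoint)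
qed (use cfgD(3)[OF a] cfgD(3)[OF b] in auto)

text \<open>A common longest path expresses that \<open>e\<close> does not increase the maximal
  length. The second clause is what non-Hamiltonicity amounts to in a connected graph.\<close>

definition blocked :: "nat \<Rightarrow> (nat \<Rightarrow> nat set) \<Rightarrow> (nat \<Rightarrow> nat set) \<Rightarrow> bool" where
  "blocked n a e \<longleftrightarrow> (let K = Gk_graph (\<lambda>v. a v \<union> e v) in
     (\<exists>p. longest_path {..<n} (Gk_graph a) p \<and> longest_path {..<n} K p) \<and>
     (\<forall>p. longest_path {..<n} K p \<longrightarrow> \<not> K (last p) (hd p)))"

text \<open>\<open>k1\<close> counts the a-choices and \<open>m\<close> each of the b- and
  d-choices. \<open>big\<close> fits all of them into the degree surplus; the bounds on
  \<open>k1\<close> serve the first-moment estimate for small sets.\<close>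

locale dense_neighbourhoods =
  fixes n k1 m :: nat and N :: "nat \<Rightarrow> nat set" and \<epsilon> :: real
  assumes N_subset: "\<And>v. v < n \<Longrightarrow> N v \<subseteq> {..<n}"
    and \<epsilon>: "0 < \<epsilon>" "\<epsilon> \<le> 1 / 2"
    and deg: "\<And>v. v < n \<Longrightarrow> (1 / 2 + \<epsilon>) * real n \<le> real (card (N v))"
    and k1: "17 \<le> k1" "m \<le> k1"
    and big: "4 * (real k1 + 2 * real m + 1) \<le> \<epsilon> * real n"
begin

text \<open>An upper bound for the share of a residual neighbourhood outside a set of about (1/2 -
  \<epsilon>/2) n vertices.\<close>

abbreviation "\<rho> \<equiv> 1 - \<epsilon> / 4"
abbreviation "t \<equiv> n div 192"

lemma \<rho>: "0 \<le> \<rho>" "\<rho> \<le> 1" "0 < \<rho>"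
  using \<epsilon> by auto

lemma finite_N: "v < n \<Longrightarrow> finite (N v)"
  by (rule finite_subset[OF N_subset]) auto

lemma n_pos: "0 < n"
proof (rule ccontr)
  assume "\<not> 0 < n"
  then show False using big by simp
qed

text \<open>From \<epsilon> \<le> 1/2 follows \<rho> (1/2 + \<epsilon>) \<ge> 1/2 + 3/4 \<epsilon>.
  By \<open>big\<close> the remaining \<epsilon> n / 4 pays for the \<open>j\<close> vertices
  already chosen and the additive 1.\<close>

lemma degree_bound:
  assumes "v < n" "x \<le> (1 / 2 + \<epsilon> / 2) * real n + 1" "j \<le> k1 + 2 * m"
  shows "x \<le> \<rho> * (real (card (N v)) - real j)"
proof -
  have "\<epsilon> * (\<epsilon> * real n) \<le> (1 / 2) * (\<epsilon> * real n)"
    using \<epsilon> by (intro mult_right_mono) auto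
  moreover have "0 \<le> \<epsilon> * real j" using \<epsilon> by simp
  moreover have "\<rho> * ((1 / 2 + \<epsilon>) * real n - real j) =
      (1 / 2 + 3 / 4 * \<epsilon>) * real n - real j + (\<epsilon> * real n) / 8 - \<epsilon> * (\<epsilon> * real n) / 4 + \<epsilon> * real j / 4"
    by (simp add: field_simps)
  ultimately have "(1 / 2 + 3 / 4 * \<epsilon>) * real n - real j \<le> \<rho> * ((1 / 2 + \<epsilon>) * real n - real j)"
    by linarith
  also have "\<dots> \<le> \<rho> * (real (card (N v)) - real j)"
    using deg[OF assms(1)] \<rho> by (intro mult_left_mono) auto
  finally have "(1 / 2 + 3 / 4 * \<epsilon>) * real n - real j \<le> \<rho> * (real (card (N v)) - real j)" .
  moreover have "real j \<le> real k1 + 2 * real m" using assms(3) by linarith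
  then have "x \<le> (1 / 2 + 3 / 4 * \<epsilon>) * real n - real j"
    using assms(2) big by (simp add: algebra_simps)
  ultimately show ?thesis by linarith
qed

lemma k_le_degree:
  assumes "v < n"
  shows "k1 + 2 * m \<le> card (N v)"
proof -
  have "real (k1 + 2 * m) \<le> real (card (N v))"
    using degree_bound[OF assms, of 0 "k1 + 2 * m"] \<rho> \<epsilon> by (simp add: zero_le_mult_iff)
  then show ?thesis by linarith
qed

text \<open>At most (1/2 + \<epsilon>/2) n + 1 vertices lie outside \<open>U v\<close>, by
  \<open>degree_bound\<close> a share of at most \<rho> of what \<open>a\<close> leaves of
  \<open>N v\<close>.\<close>

lemma card_cfg_avoid_residual:
  assumes "a \<in> cfg n N j" "j + i \<le> k1 + 2 * m" "X \<subseteq> {..<n}" "s \<le> card X"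
    and U: "\<And>v. v \<in> X \<Longrightarrow> U v \<subseteq> {..<n}" "\<And>v. v \<in> X \<Longrightarrow> (1 / 2 - \<epsilon> / 2) * real n - 1 \<le> real (card (U v))"
  shows "real (card {d \<in> cfg n (\<lambda>v. N v - a v) i. \<forall>v\<in>X. d v \<inter> U v = {}})
    \<le> (\<rho> ^ i) ^ s * real (card (cfg n (\<lambda>v. N v - a v) i))"
proof -
  have "real (card {d \<in> cfg n (\<lambda>v. N v - a v) i. \<forall>v\<in>X. d v \<inter> U v = {}})
    \<le> (\<rho> ^ i) ^ card X * real (card (cfg n (\<lambda>v. N v - a v) i))"
  proof (rule card_cfg_avoid)
    fix v assume v: "v \<in> X"
    then have vn: "v < n" using assms(3) by auto
    have "card (N v - a v - U v) \<le> card ({..<n} - U v)"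
      using N_subset[OF vn] by (intro card_mono) auto
    also have "\<dots> = n - card (U v)"
      using U(1)[OF v] by (subst card_Diff_subset) (auto intro: finite_subset)
    finally have "card (N v - a v - U v) \<le> n - card (U v)" .
    moreover have "card (U v) \<le> n"
      using card_mono[OF _ U(1)[OF v]] by simp
    ultimately have "real (card (N v - a v - U v)) \<le> real n - real (card (U v))"
      by linarith
    also have "\<dots> \<le> (1 / 2 + \<epsilon> / 2) * real n + 1"
      using U(2)[OF v] by (simp add: algebra_simps)
    finally have "real (card (N v - a v - U v)) \<le> \<rho> * (real (card (N v)) - real j)"
      using degree_bound[OF vn] assms(2) by simp
    moreover have "a v \<subseteq> N v" "card (a v) = j" "finite (N v)"
      using cfgD[OF assms(1)] vn finite_N by auto
    then have "real (card (N v - a v)) = real (card (N v)) - real j"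
      using card_mono[of "N v" "a v"] by (simp add: card_Diff_subset finite_subset of_nat_diff)
    ultimately show "real (card (N v - a v - U v)) \<le> \<rho> * real (card (N v - a v))"
      by simp
  qed (use assms \<rho> finite_N in auto)
  also have "(\<rho> ^ i) ^ card X \<le> (\<rho> ^ i) ^ s"
    using assms(4) \<rho> by (intro power_decreasing) (auto simp: power_le_one)
  finally show ?thesis by (simp add: mult_right_mono)
qed

text \<open>The set of missed vertices will depend on \<open>b\<close>, hence the union bound over
  all \<open>W\<close>, and over the start x. For a fixed pair, the choices at more than
  \<open>t\<close> endpoints y must avoid sets that are fixed before \<open>b\<close> and have at
  least \<open>card W - 1\<close> elements.\<close>

lemma card_rotations_avoid:
  assumes "a \<in> cfg n N k1" "expander {..<n} (Gk_graph a) t"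
    and q: "\<And>x y. x \<in> starts {..<n} (Gk_graph a) \<Longrightarrow> y \<in> ends {..<n} (Gk_graph a) x \<Longrightarrow>
        longest_path {..<n} (Gk_graph a) (q x y)"
  defines "B \<equiv> {b \<in> cfg n (\<lambda>v. N v - a v) m. \<exists>x\<in>starts {..<n} (Gk_graph a). \<exists>W\<subseteq>{..<n}.
      (1 / 2 - \<epsilon> / 2) * real n \<le> real (card W) \<and>
      (\<forall>y\<in>ends {..<n} (Gk_graph a) x. b y \<inter> preds {..<n} (q x y) W = {})}"
  shows "real (card B) \<le> real n * 2 ^ n * (\<rho> ^ m) ^ t * real (card (cfg n (\<lambda>v. N v - a v) m))"
proof -
  let ?C = "cfg n (\<lambda>v. N v - a v) m" and ?X = "starts {..<n} (Gk_graph a)"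
  let ?E = "ends {..<n} (Gk_graph a)"
  let ?Ws = "{W. W \<subseteq> {..<n} \<and> (1 / 2 - \<epsilon> / 2) * real n \<le> real (card W)}"
  let ?A = "\<lambda>(x, W). {b \<in> ?C. \<forall>y\<in>?E x. b y \<inter> preds {..<n} (q x y) W = {}}"
  have Xn: "?X \<subseteq> {..<n}" by (rule starts_subset)
  have fin: "finite (?X \<times> ?Ws)"
    using finite_subset[OF Xn] by auto
  have "B = (\<Union>z\<in>?X \<times> ?Ws. ?A z)"
    by (auto simp: B_def)
  then have "real (card B) \<le> (\<Sum>z\<in>?X \<times> ?Ws. real (card (?A z)))"
    using card_UN_le[OF fin, of ?A] by (simp flip: of_nat_sum)
  also have "\<dots> \<le> (\<Sum>z\<in>?X \<times> ?Ws. (\<rho> ^ m) ^ t * real (card ?C))"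
  proof (rule sum_mono)
    fix z assume "z \<in> ?X \<times> ?Ws"
    then obtain x W where z: "z = (x, W)" "x \<in> ?X" "W \<subseteq> {..<n}"
      "(1 / 2 - \<epsilon> / 2) * real n \<le> real (card W)" by blast
    have "real (card {b \<in> ?C. \<forall>y\<in>?E x. b y \<inter> preds {..<n} (q x y) W = {}})
      \<le> (\<rho> ^ m) ^ t * real (card ?C)"
    proof (rule card_cfg_avoid_residual[OF assms(1)])
      show "?E x \<subseteq> {..<n}" by (rule ends_subset)
      show "t \<le> card (?E x)"
        using card_ends[OF symp_Gk_graph _ assms(2) z(2)] by simp
      fix y assume "y \<in> ?E x"
      then have qq: "path_in {..<n} (Gk_graph a) (q x y)"
        using q[OF z(2)] by (auto simp: longest_path_def)
      then show "preds {..<n} (q x y) W \<subseteq> {..<n}"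
        using nth_mem[of _ "q x y"] by (auto simp: preds_def path_in_def subset_iff)
      have "card W \<le> Suc (card (preds {..<n} (q x y) W))"
        using qq z(3) by (intro card_preds) (auto simp: path_in_def)
      then show "(1 / 2 - \<epsilon> / 2) * real n - 1 \<le> real (card (preds {..<n} (q x y) W))"
        using z(4) by linarith
    qed simp
    then show "real (card (?A z)) \<le> (\<rho> ^ m) ^ t * real (card ?C)"
      by (simp add: z)
  qed
  also have "\<dots> = real (card ?X * card ?Ws) * ((\<rho> ^ m) ^ t * real (card ?C))"
    by (simp add: card_cartesian_product)
  also have "\<dots> \<le> real (n * 2 ^ n) * ((\<rho> ^ m) ^ t * real (card ?C))"
  proof (intro mult_right_mono)
    have "card ?X \<le> n" using card_mono[OF _ Xn] by simp
    moreover have "card ?Ws \<le> card (Pow {..<n})" by (rule card_mono) auto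
    then have "card ?Ws \<le> 2 ^ n" by (simp add: card_Pow)
    ultimately show "real (card ?X * card ?Ws) \<le> real (n * 2 ^ n)"
      by (simp only: of_nat_le_iff mult_le_mono)
  qed (use \<rho> in auto)
  finally show ?thesis by (simp add: mult_ac)
qed

text \<open>The a-graph and the full graph share a longest path, so longest paths stay longest as
  \<open>b\<close> and then \<open>d\<close> are added. The first claim takes for \<open>W\<close>
  the non-endpoints after adding \<open>b\<close>. For the second, a d-choice of x among its
  endpoints would close a longest path.\<close>

lemma ends_large:
  assumes "blocked n a (\<lambda>v. b v \<union> d v)" "x \<in> starts {..<n} (Gk_graph a)"
    and b: "\<And>v. v < n \<Longrightarrow> b v \<subseteq> {..<n}"
    and q: "\<And>y. y \<in> ends {..<n} (Gk_graph a) x \<Longrightarrow>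
        longest_path {..<n} (Gk_graph a) (q y) \<and> hd (q y) = x \<and> last (q y) = y"
    and "\<And>W. W \<subseteq> {..<n} \<Longrightarrow> (1 / 2 - \<epsilon> / 2) * real n \<le> real (card W) \<Longrightarrow>
      \<exists>y\<in>ends {..<n} (Gk_graph a) x. b y \<inter> preds {..<n} (q y) W \<noteq> {}"
  shows "(1 / 2 + \<epsilon> / 2) * real n \<le> real (card (ends {..<n} (Gk_graph (\<lambda>v. a v \<union> b v)) x))"
    and "d x \<inter> ends {..<n} (Gk_graph (\<lambda>v. a v \<union> b v)) x = {}"
proof -
  let ?V = "{..<n}" and ?Ha = "Gk_graph a" and ?Hb = "Gk_graph (\<lambda>v. a v \<union> b v)"
  let ?K = "Gk_graph (\<lambda>v. a v \<union> (b v \<union> d v))"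
  obtain p where p: "longest_path ?V ?Ha p" "longest_path ?V ?K p"
    and block: "\<And>p. longest_path ?V ?K p \<Longrightarrow> \<not> ?K (last p) (hd p)"
    using assms(1) unfolding blocked_def Let_def by blast
  have mono: "?Ha u w \<Longrightarrow> ?Hb u w" "?Hb u w \<Longrightarrow> ?K u w" for u w
    by (auto simp: Gk_graph_def)
  have "path_in ?V ?Hb p"
    using p(1) path_in_mono[of ?V ?Ha p ?Hb] mono by (auto simp: longest_path_def)
  then have pb: "longest_path ?V ?Hb p"
    by (rule longest_path_between[OF p(2)]) (use mono in auto)
  let ?W = "?V - ends ?V ?Hb x"
  have "b y \<inter> preds ?V (q y) ?W = {}" if y: "y \<in> ends ?V ?Ha x" for y
  proof -
    have qy: "longest_path ?V ?Hb (q y)"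
      by (rule longest_path_mono[OF p(1) pb]) (use mono q[OF y] in auto)
    have yn: "y < n" using y ends_subset[of ?V ?Ha x] by auto
    have "w \<notin> preds ?V (q y) ?W" if w: "w \<in> b y" for w
    proof -
      have "?Hb (last (q y)) w" using w q[OF y] by (auto simp: Gk_graph_def)
      then show ?thesis
        using preds_avoid_neighbours[OF symp_Gk_graph qy] w b[OF yn] q[OF y] by auto
    qed
    then show ?thesis by auto
  qed
  then have "\<not> (1 / 2 - \<epsilon> / 2) * real n \<le> real (card ?W)"
    using assms(5)[of ?W] by blast
  moreover have "card ?W = n - card (ends ?V ?Hb x)"
    using ends_subset[of ?V ?Hb x] by (subst card_Diff_subset) (auto intro: finite_subset)
  moreover have "card (ends ?V ?Hb x) \<le> n"
    using card_mono[OF _ ends_subset[of ?V ?Hb x]] by simp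
  ultimately show "(1 / 2 + \<epsilon> / 2) * real n \<le> real (card (ends ?V ?Hb x))"
    by (simp add: algebra_simps of_nat_diff)
  show "d x \<inter> ends ?V ?Hb x = {}"
  proof (rule ccontr)
    assume "d x \<inter> ends ?V ?Hb x \<noteq> {}"
    then obtain p' where p': "longest_path ?V ?Hb p'" "hd p' = x" "last p' \<in> d x"
      by (auto simp: ends_def)
    then have "longest_path ?V ?K p'"
      by (intro longest_path_mono[OF pb p(2)]) (use mono in auto)
    moreover have "?K (last p') (hd p')"
      using p' by (auto simp: Gk_graph_def)
    ultimately show False using block by blast
  qed
qed

text \<open>Each \<open>e\<close> is split evenly into \<open>b\<close> and \<open>d\<close>. The
  \<open>b\<close> in \<open>B\<close> are rare. For any other \<open>b\<close>, the starts have
  large end sets depending on \<open>a\<close> and \<open>b\<close> only, and the d-choices of all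
  starts must avoid them.\<close>

lemma card_blocked:
  assumes a: "a \<in> cfg n N k1" and ex: "expander {..<n} (Gk_graph a) t"
  shows "real (card {e \<in> cfg n (\<lambda>v. N v - a v) (2 * m). blocked n a e})
    \<le> (real n * 2 ^ n + 1) * (\<rho> ^ m) ^ t * real (card (cfg n (\<lambda>v. N v - a v) (2 * m)))"
proof -
  let ?V = "{..<n}" and ?Ha = "Gk_graph a"
  let ?N = "\<lambda>v. N v - a v"
  let ?C = "cfg n ?N m"
  let ?Y = "{e \<in> cfg n ?N (2 * m). blocked n a e}"
  define D where "D = (\<Prod>v<n. card (?N v) - m choose m)"
  let ?bin = "real ((2 * m choose m) ^ n)"
  \<comment> \<open>These paths depend on \<open>a\<close> alone, so the choices \<open>b\<close>
    are still free.\<close>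
  define q where "q x y = (SOME p. longest_path ?V ?Ha p \<and> hd p = x \<and> last p = y)" for x y
  have q: "longest_path ?V ?Ha (q x y) \<and> hd (q x y) = x \<and> last (q x y) = y"
    if "y \<in> ends ?V ?Ha x" for x y
  proof -
    have "\<exists>p. longest_path ?V ?Ha p \<and> hd p = x \<and> last p = y"
      using that by (auto simp: ends_def)
    from someI_ex[OF this] show ?thesis unfolding q_def .
  qed
  define B where "B = {b \<in> ?C. \<exists>x\<in>starts ?V ?Ha. \<exists>W\<subseteq>?V.
      (1 / 2 - \<epsilon> / 2) * real n \<le> real (card W) \<and>
      (\<forall>y\<in>ends ?V ?Ha x. b y \<inter> preds ?V (q x y) W = {})}"
  let ?Db = "\<lambda>b. {d \<in> cfg n (\<lambda>v. ?N v - b v) m. blocked n a (\<lambda>v. b v \<union> d v)}"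
  have finN: "finite (?N v)" if "v < n" for v
    using that finite_N by auto
  have finC: "finite ?C" using finite_cfg[OF finN] .
  have BC: "B \<subseteq> ?C" by (auto simp: B_def)
  have cardB: "real (card B) \<le> real n * 2 ^ n * (\<rho> ^ m) ^ t * real (card ?C)"
    unfolding B_def by (rule card_rotations_avoid[OF a ex]) (use q in blast)
  have cardD: "card (cfg n (\<lambda>v. ?N v - b v) m) = D" if "b \<in> ?C" for b
    unfolding D_def by (rule card_cfg_Diff[OF finN that])
  have finD: "finite (?Db b)" for b
    by (rule finite_subset[OF _ finite_cfg[of n "\<lambda>v. ?N v - b v" m]]) (use finN in auto)
  have notB: "real (card (?Db b)) \<le> (\<rho> ^ m) ^ t * real D" if b: "b \<in> ?C - B" for b
  proof (cases "?Db b = {}")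
    case True
    moreover have "0 \<le> (\<rho> ^ m) ^ t * real D"
      by (rule mult_nonneg_nonneg) (use \<rho> in simp_all)
    ultimately show ?thesis by (simp only: card.empty of_nat_0)
  next
    case False
    let ?E = "ends ?V (Gk_graph (\<lambda>v. a v \<union> b v))"
    let ?ab = "\<lambda>v. a v \<union> b v"
    have bC: "b \<in> ?C" using b by simp
    have bn: "b v \<subseteq> ?V" if "v < n" for v
      using cfgD(1)[OF bC that] N_subset[OF that] by auto
    have W: "\<exists>y\<in>ends ?V ?Ha x. b y \<inter> preds ?V (q x y) W \<noteq> {}"
      if "x \<in> starts ?V ?Ha" "W \<subseteq> ?V" "(1 / 2 - \<epsilon> / 2) * real n \<le> real (card W)" for x W
      using b that by (auto simp: B_def)
    have large: "(1 / 2 + \<epsilon> / 2) * real n \<le> real (card (?E x))" "d x \<inter> ?E x = {}"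
      if d: "d \<in> ?Db b" and x: "x \<in> starts ?V ?Ha" for d x
    proof -
      have bl: "blocked n a (\<lambda>v. b v \<union> d v)" using d by simp
      show "(1 / 2 + \<epsilon> / 2) * real n \<le> real (card (?E x))"
        by (rule ends_large(1)[where q = "q x", OF bl x bn]) (simp_all add: q W[OF x])
      show "d x \<inter> ?E x = {}"
        by (rule ends_large(2)[where q = "q x", OF bl x bn]) (simp_all add: q W[OF x])
    qed
    have ab: "?ab \<in> cfg n N (k1 + m)"
      by (rule cfg_union[OF finite_N a bC])
    have NN: "(\<lambda>v. ?N v - b v) = (\<lambda>v. N v - ?ab v)" by auto
    \<comment> \<open>One blocking \<open>d0\<close> suffices for the lower bound on
      \<open>?E x\<close>, since this set does not depend on \<open>d\<close>.\<close>
    obtain d0 where d0: "d0 \<in> ?Db b" using False by blast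
    have "card (?Db b) \<le> card {d \<in> cfg n (\<lambda>v. N v - ?ab v) m. \<forall>x\<in>starts ?V ?Ha. d x \<inter> ?E x = {}}"
    proof (rule card_mono)
      show "finite {d \<in> cfg n (\<lambda>v. N v - ?ab v) m. \<forall>x\<in>starts ?V ?Ha. d x \<inter> ?E x = {}}"
        by (rule finite_subset[OF _ finite_cfg[of n "\<lambda>v. N v - ?ab v" m]]) (use finite_N in auto)
      show "?Db b \<subseteq> {d \<in> cfg n (\<lambda>v. N v - ?ab v) m. \<forall>x\<in>starts ?V ?Ha. d x \<inter> ?E x = {}}"
      proof
        fix d assume d: "d \<in> ?Db b"
        show "d \<in> {d \<in> cfg n (\<lambda>v. N v - ?ab v) m. \<forall>x\<in>starts ?V ?Ha. d x \<inter> ?E x = {}}"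
          using d large(2)[OF d] by (simp add: NN)
      qed
    qed
    then have "real (card (?Db b)) \<le> real (card {d \<in> cfg n (\<lambda>v. N v - ?ab v) m. \<forall>x\<in>starts ?V ?Ha. d x \<inter> ?E x = {}})"
      by simp
    also have "\<dots> \<le> (\<rho> ^ m) ^ t * real (card (cfg n (\<lambda>v. N v - ?ab v) m))"
    proof (rule card_cfg_avoid_residual[OF ab])
      show "starts ?V ?Ha \<subseteq> ?V" by (rule starts_subset)
      show "t \<le> card (starts ?V ?Ha)"
        using card_starts[OF symp_Gk_graph _ ex] n_pos by (simp add: lessThan_empty_iff)
      fix x assume x: "x \<in> starts ?V ?Ha"
      show "?E x \<subseteq> ?V" by (rule ends_subset)
      have "(1 / 2 + \<epsilon> / 2) * real n \<le> real (card (?E x))"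
        by (rule large(1)[OF d0 x])
      moreover have "0 \<le> \<epsilon> * real n" using \<epsilon> by simp
      ultimately show "(1 / 2 - \<epsilon> / 2) * real n - 1 \<le> real (card (?E x))"
        by (simp add: algebra_simps)
    qed simp
    also have "card (cfg n (\<lambda>v. N v - ?ab v) m) = D"
      using cardD[OF bC] by (simp add: NN)
    finally show ?thesis .
  qed
  have total: "real (card ?C) * real D = real (card (cfg n ?N (2 * m))) * ?bin"
  proof -
    have "2 * m \<le> card (N v - a v)" if "v < n" for v
      using cfgD(2)[OF a that] k_le_degree[OF that]
        card_Diff_subset[OF finite_subset[OF cfgD(1)[OF a that] finite_N[OF that]] cfgD(1)[OF a that]]
      by simp
    then have "card ?C * (\<Prod>v<n. card (?N v) - m choose (2 * m - m)) = card (cfg n ?N (2 * m)) * (2 * m choose m) ^ n"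
      by (intro card_cfg_mult finN) auto
    then have "card ?C * D = card (cfg n ?N (2 * m)) * (2 * m choose m) ^ n"
      by (simp add: D_def mult_2)
    then show ?thesis by (simp only: of_nat_mult[symmetric])
  qed
  have "card ?Y * (2 * m choose m) ^ n \<le> card (SIGMA b:?C. ?Db b)"
  proof -
    \<comment> \<open>Nothing is forced into the first half, so all splittings count;
      \<open>total\<close> supplies the same factor for cancellation.\<close>
    have "card ?Y * (2 * m - 0 choose (m - 0)) ^ n \<le>
      card (SIGMA b:?C. {d \<in> cfg n (\<lambda>v. ?N v - b v) (2 * m - m).
        (\<lambda>v. b v \<union> d v) \<in> ?Y \<and> (\<forall>v<n. {} \<subseteq> b v)})"
      by (rule card_cfg_split[where F = "\<lambda>_ _. {}"]) (use finN in auto)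
    also have "\<dots> \<le> card (SIGMA b:?C. ?Db b)"
      using finC finD by (intro card_mono finite_SigmaI) auto
    finally show ?thesis by simp
  qed
  then have "real (card ?Y) * ?bin \<le> real (card (SIGMA b:?C. ?Db b))"
    by (simp only: of_nat_mult[symmetric] of_nat_le_iff)
  also have "\<dots> = (\<Sum>b\<in>?C. real (card (?Db b)))"
    using finC finD by (simp add: card_SigmaI)
  also have "\<dots> = (\<Sum>b\<in>B. real (card (?Db b))) + (\<Sum>b\<in>?C - B. real (card (?Db b)))"
    using sum.subset_diff[OF BC finC] by (simp add: add.commute)
  also have "\<dots> \<le> (\<Sum>b\<in>B. real D) + (\<Sum>b\<in>?C - B. (\<rho> ^ m) ^ t * real D)"
  proof (rule add_mono; rule sum_mono)
    fix b assume "b \<in> B"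
    then have "b \<in> ?C" using BC by blast
    have "card (?Db b) \<le> card (cfg n (\<lambda>v. ?N v - b v) m)"
      by (rule card_mono[OF finite_cfg]) (use finN in auto)
    then show "real (card (?Db b)) \<le> real D"
      using cardD[OF \<open>b \<in> ?C\<close>] by simp
  qed (use notB in blast)
  also have "\<dots> = real (card B) * real D + real (card (?C - B)) * ((\<rho> ^ m) ^ t * real D)"
    by simp
  also have "\<dots> \<le> (real n * 2 ^ n * (\<rho> ^ m) ^ t * real (card ?C)) * real D
      + real (card ?C) * ((\<rho> ^ m) ^ t * real D)"
  proof (intro add_mono mult_right_mono[OF cardB] mult_right_mono)
    show "real (card (?C - B)) \<le> real (card ?C)"
      using finC by (simp add: card_mono)
    show "0 \<le> (\<rho> ^ m) ^ t * real D"
      by (intro mult_nonneg_nonneg zero_le_power \<rho>) simp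
  qed simp
  also have "\<dots> = (real n * 2 ^ n + 1) * (\<rho> ^ m) ^ t * (real (card ?C) * real D)"
    by (simp add: algebra_simps)
  also have "\<dots> = (real n * 2 ^ n + 1) * (\<rho> ^ m) ^ t * real (card (cfg n ?N (2 * m))) * ?bin"
    unfolding total by (simp only: mult.assoc)
  finally show ?thesis
    by (rule mult_right_le_imp_le) simp
qed

end

section \<open>Expansion, connectivity and the final count\<close>

text \<open>One term of the exponential series gives s^s / s! \<le> e^s \<le> 3^s, and (n choose s)
  is at most n^s / s!.\<close>

lemma choose_le_power_div:
  assumes "0 < s"
  shows "real (n choose s) \<le> (3 * real n / real s) ^ s"
proof -
  have "(\<Sum>j\<in>{s}. real s ^ j /\<^sub>R fact j) \<le> (\<Sum>j. real s ^ j /\<^sub>R fact j)"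
    by (rule sum_le_suminf) (use exp_converges[of "real s"] in \<open>auto simp: sums_iff\<close>)
  also have "\<dots> = exp (real s)"
    using exp_converges[of "real s"] by (simp add: sums_iff)
  also have "\<dots> = exp 1 ^ s"
    by (simp flip: exp_of_nat_mult)
  also have "\<dots> \<le> 3 ^ s"
    using exp_le by (intro power_mono) auto
  finally have "real s ^ s \<le> 3 ^ s * fact s"
    by (simp add: field_simps)
  then have "real (n choose s) * real s ^ s \<le> real (n choose s) * (3 ^ s * fact s)"
    by (rule mult_left_mono) simp
  also have "\<dots> = 3 ^ s * real ((n choose s) * fact s)"
    by simp
  also have "\<dots> \<le> 3 ^ s * real (n ^ s)"
    using binomial_fact_pow[of n s] by (intro mult_left_mono) (simp_all only: of_nat_le_iff, simp)
  finally show ?thesis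
    using assms by (simp add: field_simps power_mult_distrib)
qed

text \<open>The quotient is k (k - 1) / (j (j - 1)), and j \<ge> 3 gives k - 1 \<le> 4 (j - 1). It
  is the price per vertex of forcing two choices into the first part.\<close>

lemma choose_ratio:
  assumes "3 \<le> j" "j \<le> k" "k \<le> 3 * j"
  shows "(k choose j) \<le> 12 * (k - 2 choose (j - 2))"
proof -
  obtain j' k' where j: "j = Suc (Suc j')" "k = Suc (Suc k')"
    using assms by (metis add_2_eq_Suc le_add_diff_inverse le_trans numeral_le_iff semiring_norm(68,72) le_SucE numeral_3_eq_3 Suc_le_D)
  have "j * (j - 1) * (k choose j) = k * (k - 1) * (k - 2 choose (j - 2))"
    using Suc_times_binomial_eq[of "Suc k'" "Suc j'"] Suc_times_binomial_eq[of k' j']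
    by (simp add: j algebra_simps)
  also have "k * (k - 1) \<le> (3 * j) * (4 * (j - 1))"
    using assms by (intro mult_le_mono) auto
  then have "k * (k - 1) * (k - 2 choose (j - 2)) \<le> j * (j - 1) * (12 * (k - 2 choose (j - 2)))"
    by (simp add: mult.assoc mult_le_mono1)
  finally show ?thesis
    by (rule mult_left_le_imp_le) (use assms in simp)
qed

text \<open>The left side is a first-moment term for pairs of sets of sizes s and 3 s. With y = 48 s
  / n it is at most the s-th power of a constant times \<open>y ^ (j - 4)\<close>, and y \<le> 1/4
  because 192 = 4 * 48.\<close>

lemma small_set_term_bound:
  assumes "1 \<le> s" "s \<le> n div 192" "17 \<le> j" "k \<le> 3 * j"
  shows "real (n choose s) * real (n choose (3 * s)) * (2 ^ k * (6 * real s / real n) ^ j) ^ s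
    \<le> 48 / real n * (1 / 2) ^ (s - 1)"
proof -
  define y where "y = 48 * real s / real n"
  have sn: "192 * s \<le> n" using assms(2) by linarith
  have n: "0 < n" using assms(1) sn by linarith
  have "192 * real s \<le> real n" using sn by linarith
  then have y: "0 < y" "y \<le> 1 / 4"
    using assms(1) n by (auto simp: y_def field_simps)
  have "real (n choose s) \<le> (144 / y) ^ s"
    using choose_le_power_div[of s n] assms(1) n by (simp add: y_def)
  moreover have "real (n choose (3 * s)) \<le> ((48 / y) ^ 3) ^ s"
    using choose_le_power_div[of "3 * s" n] assms(1) n by (simp add: y_def power_mult[symmetric])
  moreover have "2 ^ k * (6 * real s / real n) ^ j \<le> y ^ j"
  proof -
    have "(2::real) ^ k \<le> 2 ^ (3 * j)" by (rule power_increasing) (use assms in auto)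
    also have "\<dots> = 8 ^ j" by (simp add: power_mult)
    finally have "2 ^ k * (6 * real s / real n) ^ j \<le> 8 ^ j * (6 * real s / real n) ^ j"
      by (rule mult_right_mono) simp
    also have "\<dots> = y ^ j" by (simp add: y_def flip: power_mult_distrib)
    finally show ?thesis .
  qed
  then have "(2 ^ k * (6 * real s / real n) ^ j) ^ s \<le> (y ^ j) ^ s"
    by (rule power_mono) simp
  ultimately have "real (n choose s) * real (n choose (3 * s)) * (2 ^ k * (6 * real s / real n) ^ j) ^ s
    \<le> (144 / y) ^ s * ((48 / y) ^ 3) ^ s * (y ^ j) ^ s"
    using y by (intro mult_mono) auto
  also have "\<dots> = (144 / y * (48 / y) ^ 3 * y ^ j) ^ s"
    by (simp only: power_mult_distrib)
  also have "144 / y * (48 / y) ^ 3 * y ^ j = 15925248 * (y ^ (j - 5) * y)"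
  proof -
    have "y ^ j = y ^ 4 * (y ^ (j - 5) * y)"
    proof -
      have "j = (j - 5) + 5" using assms(3) by simp
      then have "y ^ j = y ^ (j - 5) * y ^ 5" by (metis power_add)
      then show ?thesis by (simp add: eval_nat_numeral mult_ac)
    qed
    then show ?thesis using y by (simp add: field_simps power3_eq_cube power4_eq_xxxx)
  qed
  also have "(15925248 * (y ^ (j - 5) * y)) ^ s \<le> y ^ s"
  proof (rule power_mono)
    \<comment> \<open>The constant 15925248 = 144 * 48^3 is just below 4^12, so an exponent of 12 is
      wanted, and 17 \<le> j provides it.\<close>
    have "y ^ (j - 5) \<le> y ^ 12"
      using y assms(3) by (intro power_decreasing) auto
    also have "\<dots> \<le> (1 / 4) ^ 12"
      using y by (intro power_mono) auto
    also have "(1 / 4 :: real) ^ 12 = 1 / 16777216" by (simp add: power_divide)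
    finally have "15925248 * y ^ (j - 5) \<le> 1" by linarith
    then show "15925248 * (y ^ (j - 5) * y) \<le> y"
      using y mult_right_mono[of "15925248 * y ^ (j - 5)" 1 y] by (simp add: mult.assoc)
  qed (use y in simp)
  also have "y ^ s = y * y ^ (s - 1)"
    using assms(1) by (simp flip: power_Suc)
  also have "\<dots> \<le> y * (1 / 4) ^ (s - 1)"
    using y by (intro mult_left_mono power_mono) auto
  also have "\<dots> = 48 / real n * (real s * (1 / 4) ^ (s - 1))"
    by (simp add: y_def)
  also have "\<dots> \<le> 48 / real n * (1 / 2) ^ (s - 1)"
  proof (rule mult_left_mono)
    \<comment> \<open>Weakening the ratio 1/4 to 1/2 absorbs the factor s contained in y, leaving
      1/n times a summable series.\<close>
    have "s \<le> 2 ^ (s - 1)"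
      using less_exp[of "s - 1"] assms(1) by linarith
    then have "real s \<le> 2 ^ (s - 1)"
      by (metis of_nat_le_iff of_nat_numeral of_nat_power)
    then have "real s * (1 / 4) ^ (s - 1) \<le> 2 ^ (s - 1) * (1 / 4) ^ (s - 1)"
      by (rule mult_right_mono) simp
    also have "\<dots> = (1 / 2) ^ (s - 1)" by (simp flip: power_mult_distrib)
    finally show "real s * (1 / 4) ^ (s - 1) \<le> (1 / 2) ^ (s - 1)" .
  qed simp
  finally show ?thesis .
qed

lemma sum_half_powers_le: "(\<Sum>s=1..r. (1 / 2 :: real) ^ (s - 1)) \<le> 2"
proof -
  have "(\<Sum>s=1..r. (1 / 2 :: real) ^ (s - 1)) = 2 - 2 * (1 / 2) ^ r"
    by (induction r) auto
  then show ?thesis by simp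
qed

section \<open>Exceptional configurations and non-Hamiltonian outcomes\<close>

context dense_neighbourhoods
begin

abbreviation "\<kappa> \<equiv> k1 + 2 * m"

text \<open>All \<kappa> choices are inspected against the threshold \<open>k1\<close>. Outside this
  event every selection of \<open>k1\<close> choices per vertex expands, without a union bound over
  selections.\<close>

definition concentrated :: "(nat \<Rightarrow> nat set) \<Rightarrow> bool" where
  "concentrated c \<longleftrightarrow> (\<exists>S W. S \<subseteq> W \<and> W \<subseteq> {..<n} \<and> S \<noteq> {} \<and> card S \<le> t \<and> card W = 3 * card S \<and>
     (\<forall>v\<in>S. k1 \<le> card (c v \<inter> W)))"

text \<open>The obstruction to connectivity that \<open>concentrated\<close> leaves open. Sets of at
  most n / 2 vertices suffice, since every cut has such a side.\<close>

definition separated :: "(nat \<Rightarrow> nat set) \<Rightarrow> bool" where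
  "separated c \<longleftrightarrow> (\<exists>S. S \<subseteq> {..<n} \<and> t \<le> card S \<and> 2 * card S \<le> n \<and> (\<forall>v\<in>S. c v \<subseteq> S))"

lemma ex_triple_superset:
  assumes "S \<subseteq> T" "T \<subseteq> {..<n}" "card T \<le> 3 * card S" "card S \<le> t"
  obtains W where "T \<subseteq> W" "W \<subseteq> {..<n}" "card W = 3 * card S"
proof -
  have "finite T" using assms(2) finite_subset by blast
  then have "3 * card S - card T \<le> card ({..<n} - T)"
    using assms by (simp add: card_Diff_subset)
  then obtain D where D: "D \<subseteq> {..<n} - T" "card D = 3 * card S - card T"
    by (metis obtain_subset_with_card_n)
  have "card (T \<union> D) = 3 * card S"
    using D assms \<open>finite T\<close> by (subst card_Un_disjoint) (auto intro: finite_subset)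
  then show ?thesis using that[of "T \<union> D"] D assms by auto
qed

text \<open>The closed neighbourhood of a poorly expanding set fits into a \<open>W\<close> of three
  times its size and contains all the choices \<open>a v\<close>, which are also choices of
  \<open>c\<close>.\<close>

lemma expander_subconfiguration:
  assumes c: "c \<in> cfg n N \<kappa>" "\<not> concentrated c" and a: "a \<in> cfg n N k1" "\<And>v. v < n \<Longrightarrow> a v \<subseteq> c v"
  shows "expander {..<n} (Gk_graph a) t"
  unfolding expander_def
proof (intro allI impI, rule ccontr)
  fix S assume S: "S \<subseteq> {..<n}" "S \<noteq> {}" "card S \<le> t"
  let ?T = "S \<union> {w \<in> {..<n}. \<exists>r\<in>S. Gk_graph a r w}"
  assume "\<not> 3 * card S < card ?T"
  then obtain W where W: "?T \<subseteq> W" "W \<subseteq> {..<n}" "card W = 3 * card S"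
    using ex_triple_superset[of S ?T] S by auto
  have "k1 \<le> card (c v \<inter> W)" if v: "v \<in> S" for v
  proof -
    have vn: "v < n" using v S by auto
    have "a v \<subseteq> ?T"
      using cfgD(1)[OF a(1) vn] N_subset[OF vn] v by (auto simp: Gk_graph_def)
    then have "a v \<subseteq> c v \<inter> W" using a(2)[OF vn] W by blast
    moreover have "finite (c v \<inter> W)" using W finite_subset by blast
    ultimately have "card (a v) \<le> card (c v \<inter> W)" by (simp add: card_mono)
    then show ?thesis using cfgD(2)[OF a(1) vn] by simp
  qed
  then have "concentrated c"
    unfolding concentrated_def using S W by (intro exI[of _ S] exI[of _ W]) auto
  then show False using c by blast
qed

text \<open>Consider the side of the cut with at most n / 2 vertices. If it has at most
  \<open>t\<close>, some vertex has fewer than \<open>k1\<close> choices in a superset of triple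
  size and so leaves the side; otherwise the failure of \<open>separated\<close> gives such a
  vertex.\<close>

lemma configuration_connected:
  assumes c: "c \<in> cfg n N \<kappa>" "\<not> concentrated c" "\<not> separated c"
    and C: "C \<noteq> {}" "C \<subset> {..<n}"
  shows "\<exists>u\<in>C. \<exists>w\<in>{..<n} - C. Gk_graph c u w"
proof -
  have leaves: "\<exists>v\<in>S. \<exists>w\<in>{..<n} - S. w \<in> c v" if S: "S \<subseteq> {..<n}" "S \<noteq> {}" "2 * card S \<le> n" for S
  proof -
    have "\<exists>v\<in>S. \<not> c v \<subseteq> S"
    proof (cases "card S \<le> t")
      case True
      obtain W where W: "S \<subseteq> W" "W \<subseteq> {..<n}" "card W = 3 * card S"
        using ex_triple_superset[of S S] S True by auto
      then obtain v where v: "v \<in> S" "\<not> k1 \<le> card (c v \<inter> W)"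
        using c(2) S True unfolding concentrated_def by blast
      have "card (c v) = \<kappa>" using cfgD(2)[OF c(1)] v S by auto
      then have "\<not> c v \<subseteq> W" using v by (auto simp: Int_absorb2)
      then show ?thesis using v W by blast
    next
      case False
      then show ?thesis using c(3) S unfolding separated_def by (meson nat_le_linear)
    qed
    then obtain v w where vw: "v \<in> S" "w \<in> c v" "w \<notin> S" by blast
    then have "w < n" using cfgD(1)[OF c(1), of v] N_subset[of v] S by auto
    then show ?thesis using vw by blast
  qed
  have finC: "finite C" using C finite_subset by blast
  show ?thesis
  proof (cases "2 * card C \<le> n")
    case True
    then show ?thesis using leaves[of C] C by (auto simp: Gk_graph_def)
  next
    case False
    have "card ({..<n} - C) = n - card C" using C finC by (subst card_Diff_subset) auto
    then have "\<exists>v\<in>{..<n} - C. \<exists>w\<in>{..<n} - ({..<n} - C). w \<in> c v"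
      using False C by (intro leaves) auto
    then show ?thesis by (auto simp: Gk_graph_def)
  qed
qed

lemma card_concentrated:
  "real (card {c \<in> cfg n N \<kappa>. concentrated c}) \<le> 96 / real n * real (card (cfg n N \<kappa>))"
proof -
  let ?C = "real (card (cfg n N \<kappa>))"
  let ?A = "\<lambda>(S, W). {c \<in> cfg n N \<kappa>. \<forall>v\<in>S. k1 \<le> card (c v \<inter> W)}"
  let ?P = "\<lambda>s. {S. S \<subseteq> {..<n} \<and> card S = s} \<times> {W. W \<subseteq> {..<n} \<and> card W = 3 * s}"
  let ?\<delta> = "\<lambda>s. 2 ^ \<kappa> * (6 * real s / real n) ^ k1"
  have finA: "finite (?A z)" for z
    by (cases z) (auto intro: finite_subset[OF _ finite_cfg[OF finite_N]])
  have finP: "finite (?P s)" for s by auto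
  have bound: "real (card (?A z)) \<le> ?\<delta> s ^ s * ?C" if s: "s \<in> {1..t}" and z: "z \<in> ?P s" for s z
  proof -
    obtain S W where SW: "z = (S, W)" "S \<subseteq> {..<n}" "card S = s" "W \<subseteq> {..<n}" "card W = 3 * s"
      using z by auto
    have "192 * s \<le> n" using s by auto
    then have sn: "6 * real s \<le> real n" by linarith
    have "real (card {c \<in> cfg n N \<kappa>. \<forall>v\<in>S. k1 \<le> card (c v \<inter> W)}) \<le> ?\<delta> s ^ card S * ?C"
    proof (rule card_cfg_restrict[OF finite_N SW(2)])
      fix v assume "v \<in> S"
      then have vn: "v < n" using SW by auto
      have "0 \<le> \<epsilon> * real n" using \<epsilon> by simp
      then have d: "real n / 2 \<le> real (card (N v))"
        using deg[OF vn] by (simp add: algebra_simps)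
      \<comment> \<open>The 3 s vertices of \<open>W\<close> are set against a degree of at least n
        / 2, hence the density 6 s / n.\<close>
      have "real (card W) = 6 * real s / real n * (real n / 2)"
        using SW n_pos by simp
      also have "\<dots> \<le> 6 * real s / real n * real (card (N v))"
        using d by (intro mult_left_mono) auto
      finally show "real (card {S. S \<subseteq> N v \<and> card S = \<kappa> \<and> k1 \<le> card (S \<inter> W)})
        \<le> ?\<delta> s * real (card (N v) choose \<kappa>)"
        using vn sn n_pos SW k_le_degree[OF vn]
        by (intro card_subsets_concentrated finite_N) (auto intro: finite_subset)
    qed simp_all
    then show ?thesis using SW by simp
  qed
  have "{c \<in> cfg n N \<kappa>. concentrated c} \<subseteq> (\<Union>s\<in>{1..t}. \<Union>z\<in>?P s. ?A z)"
  proof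
    fix c assume "c \<in> {c \<in> cfg n N \<kappa>. concentrated c}"
    then obtain S W where SW: "S \<subseteq> W" "W \<subseteq> {..<n}" "S \<noteq> {}" "card S \<le> t" "card W = 3 * card S"
        "\<forall>v\<in>S. k1 \<le> card (c v \<inter> W)" and c: "c \<in> cfg n N \<kappa>"
      unfolding concentrated_def by blast
    have "finite S" using SW finite_subset by (metis finite_lessThan)
    then have "card S \<in> {1..t}" using SW by (simp add: Suc_le_eq card_gt_0_iff)
    moreover have "(S, W) \<in> ?P (card S)" using SW by auto
    moreover have "c \<in> ?A (S, W)" using SW c by auto
    ultimately show "c \<in> (\<Union>s\<in>{1..t}. \<Union>z\<in>?P s. ?A z)" by blast
  qed
  then have "card {c \<in> cfg n N \<kappa>. concentrated c} \<le> card (\<Union>s\<in>{1..t}. \<Union>z\<in>?P s. ?A z)"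
    using finA finP by (intro card_mono finite_UN_I) auto
  also have "\<dots> \<le> (\<Sum>s=1..t. card (\<Union>z\<in>?P s. ?A z))"
    by (rule card_UN_le) simp
  also have "\<dots> \<le> (\<Sum>s=1..t. \<Sum>z\<in>?P s. card (?A z))"
    by (intro sum_mono card_UN_le finP)
  finally have "real (card {c \<in> cfg n N \<kappa>. concentrated c}) \<le> real (\<Sum>s=1..t. \<Sum>z\<in>?P s. card (?A z))"
    by (simp only: of_nat_le_iff)
  also have "\<dots> = (\<Sum>s=1..t. \<Sum>z\<in>?P s. real (card (?A z)))"
    by (simp only: of_nat_sum)
  also have "\<dots> \<le> (\<Sum>s=1..t. \<Sum>z\<in>?P s. ?\<delta> s ^ s * ?C)"
    by (intro sum_mono bound)
  also have "\<dots> = (\<Sum>s=1..t. (real (n choose s) * real (n choose (3 * s)) * ?\<delta> s ^ s) * ?C)"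
    by (intro sum.cong refl) (simp add: card_cartesian_product n_subsets mult.assoc)
  also have "\<dots> \<le> (\<Sum>s=1..t. (48 / real n * (1 / 2) ^ (s - 1)) * ?C)"
    using k1 by (intro sum_mono mult_right_mono small_set_term_bound) auto
  also have "\<dots> = (48 / real n * (\<Sum>s=1..t. (1 / 2) ^ (s - 1))) * ?C"
    by (simp only: sum_distrib_left sum_distrib_right)
  also have "\<dots> \<le> (48 / real n * 2) * ?C"
    by (intro mult_right_mono mult_left_mono sum_half_powers_le) auto
  finally show ?thesis by simp
qed

text \<open>At most n / 2 vertices of a neighbourhood lie in S, a share of at most \<rho>. The
  exponents are then lowered to those of the other error terms.\<close>

lemma card_separated:
  "real (card {c \<in> cfg n N \<kappa>. separated c}) \<le> 2 ^ n * (\<rho> ^ m) ^ t * real (card (cfg n N \<kappa>))"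
proof -
  let ?C = "real (card (cfg n N \<kappa>))"
  let ?I = "{S. S \<subseteq> {..<n} \<and> t \<le> card S \<and> 2 * card S \<le> n}"
  let ?A = "\<lambda>S. {c \<in> cfg n N \<kappa>. \<forall>v\<in>S. c v \<inter> (UNIV - S) = {}}"
  have finI: "finite ?I" by (rule finite_subset[of _ "Pow {..<n}"]) auto
  have finA: "finite (?A S)" for S
    by (auto intro: finite_subset[OF _ finite_cfg[OF finite_N]])
  have bound: "real (card (?A S)) \<le> (\<rho> ^ m) ^ t * ?C" if S: "S \<in> ?I" for S
  proof -
    have "real (card (?A S)) \<le> (\<rho> ^ \<kappa>) ^ card S * ?C"
    proof (rule card_cfg_avoid[OF finite_N])
      fix v assume "v \<in> S"
      then have vn: "v < n" using S by auto
      have "finite S" using S finite_subset by blast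
      then have "card (N v - (UNIV - S)) \<le> card S" by (intro card_mono) auto
      moreover have "2 * card S \<le> n" using S by simp
      ultimately have "2 * real (card (N v - (UNIV - S))) \<le> real n" by linarith
      moreover have "0 \<le> \<epsilon> * real n" using \<epsilon> by simp
      ultimately have "real (card (N v - (UNIV - S))) \<le> (1 / 2 + \<epsilon> / 2) * real n + 1"
        by (simp add: algebra_simps)
      then show "real (card (N v - (UNIV - S))) \<le> \<rho> * real (card (N v))"
        using degree_bound[OF vn, of _ 0] by simp
    qed (use S \<rho> in auto)
    also have "(\<rho> ^ \<kappa>) ^ card S \<le> (\<rho> ^ \<kappa>) ^ t"
      using S \<rho> by (intro power_decreasing) (auto simp: power_le_one)
    also have "(\<rho> ^ \<kappa>) ^ t \<le> (\<rho> ^ m) ^ t"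
      using \<rho> by (intro power_mono power_decreasing) auto
    finally show ?thesis by (simp add: mult_right_mono)
  qed
  have "{c \<in> cfg n N \<kappa>. separated c} \<subseteq> (\<Union>S\<in>?I. ?A S)"
    by (fastforce simp: separated_def)
  then have "card {c \<in> cfg n N \<kappa>. separated c} \<le> card (\<Union>S\<in>?I. ?A S)"
    using finI finA by (intro card_mono finite_UN_I) auto
  also have "\<dots> \<le> (\<Sum>S\<in>?I. card (?A S))"
    by (rule card_UN_le[OF finI])
  finally have "real (card {c \<in> cfg n N \<kappa>. separated c}) \<le> real (\<Sum>S\<in>?I. card (?A S))"
    by (simp only: of_nat_le_iff)
  also have "\<dots> = (\<Sum>S\<in>?I. real (card (?A S)))" by (simp only: of_nat_sum)
  also have "\<dots> \<le> (\<Sum>S\<in>?I. (\<rho> ^ m) ^ t * ?C)" by (rule sum_mono[OF bound])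
  also have "\<dots> = real (card ?I) * ((\<rho> ^ m) ^ t * ?C)" by simp
  also have "\<dots> \<le> 2 ^ n * ((\<rho> ^ m) ^ t * ?C)"
  proof (rule mult_right_mono)
    have "card ?I \<le> card (Pow {..<n})" by (rule card_mono) auto
    then have "card ?I \<le> 2 ^ n" by (simp add: card_Pow)
    then have "real (card ?I) \<le> real (2 ^ n)" by (simp only: of_nat_le_iff)
    then show "real (card ?I) \<le> 2 ^ n" by simp
  qed (use \<rho> in auto)
  finally show ?thesis by (simp add: mult.assoc)
qed

text \<open>Counts splittings whose a-part keeps a fixed longest path. Each configuration has many
  of them, while by \<open>card_blocked\<close> each expanding \<open>a\<close> admits few
  \<open>e\<close>; the factor 12 per vertex comes from \<open>choose_ratio\<close>.\<close>

lemma card_connected_nonhamiltonian: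
  assumes n3: "n \<ge> 3"
  shows "real (card {c \<in> cfg n N \<kappa>. \<not> concentrated c \<and> \<not> separated c \<and> \<not> hamiltonian n (Gk_graph c)})
    \<le> 12 ^ n * ((real n * 2 ^ n + 1) * (\<rho> ^ m) ^ t) * real (card (cfg n N \<kappa>))"
proof -
  let ?V = "{..<n}"
  define X where "X = {c \<in> cfg n N \<kappa>. \<not> concentrated c \<and> \<not> separated c \<and> \<not> hamiltonian n (Gk_graph c)}"
  define q where "q = (real n * 2 ^ n + 1) * (\<rho> ^ m) ^ t"
  have q0: "0 \<le> q" unfolding q_def by (intro mult_nonneg_nonneg zero_le_power \<rho>) simp
  define P where "P c = (SOME p. longest_path ?V (Gk_graph c) p)" for c :: "nat \<Rightarrow> nat set"
  have P: "longest_path ?V (Gk_graph c) (P c)" for c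
  proof -
    have "?V \<noteq> {}" using n_pos by auto
    then have "\<exists>p. longest_path ?V (Gk_graph c) p"
      using longest_path_exists[of ?V "Gk_graph c"] by auto
    then show ?thesis unfolding P_def by (rule someI_ex)
  qed
  \<comment> \<open>The choices of v that produce path edges. Keeping them at every v keeps the
    whole path, whichever end chose an edge.\<close>
  define F where "F c v = {w \<in> c v. path_adj (P c) v w}" for c v
  let ?R = "\<lambda>a. {e \<in> cfg n (\<lambda>v. N v - a v) (\<kappa> - k1).
        (\<lambda>v. a v \<union> e v) \<in> X \<and> (\<forall>v<n. F (\<lambda>v. a v \<union> e v) v \<subseteq> a v)}"
  define D where "D = (\<Prod>v<n. card (N v) - k1 choose (2 * m))"
  have finR: "finite (?R a)" for a
    by (rule finite_subset[OF _ finite_cfg[of n "\<lambda>v. N v - a v" "\<kappa> - k1"]]) (use finite_N in auto)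
  have R_bound: "real (card (?R a)) \<le> q * real D" if a: "a \<in> cfg n N k1" for a
  proof (cases "?R a = {}")
    case True
    then show ?thesis using q0 by (simp only: card.empty of_nat_0) simp
  next
    case False
    \<comment> \<open>A single valid \<open>e0\<close> already places \<open>a\<close> inside a
      configuration that is not \<open>concentrated\<close>, so \<open>a\<close> expands.\<close>
    then obtain e0 where e0: "(\<lambda>v. a v \<union> e0 v) \<in> X" by blast
    have ex: "expander ?V (Gk_graph a) t"
      by (rule expander_subconfiguration[of "\<lambda>v. a v \<union> e0 v"]) (use e0 a in \<open>auto simp: X_def\<close>)
    have "?R a \<subseteq> {e \<in> cfg n (\<lambda>v. N v - a v) (2 * m). blocked n a e}"
    proof
      fix e assume e: "e \<in> ?R a"
      let ?c = "\<lambda>v. a v \<union> e v"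
      let ?K = "Gk_graph ?c"
      have c: "?c \<in> cfg n N \<kappa>" "\<not> concentrated ?c" "\<not> separated ?c" "\<not> hamiltonian n ?K"
        using e by (simp_all add: X_def)
      have F: "w \<in> a u" if "w \<in> ?c u" "path_adj (P ?c) u w" for u w
      proof -
        have "u < n" using cfgD(3)[OF c(1), of u] that by (cases "u < n") auto
        then have "F ?c u \<subseteq> a u" using e by simp
        then show ?thesis using that by (auto simp: F_def)
      qed
      have "path_in ?V (Gk_graph a) (P ?c)"
      proof (rule path_in_mono)
        show "path_in ?V ?K (P ?c)" using P by (simp add: longest_path_def)
        fix u w assume "path_adj (P ?c) u w" "?K u w"
        then show "Gk_graph a u w"
          using F[of w u] F[of u w] path_adj_commute[of "P ?c" u w] unfolding Gk_graph_def by blast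
      qed
      then have "longest_path ?V (Gk_graph a) (P ?c)"
        by (rule longest_path_between[OF P]) (auto simp: Gk_graph_def)
      moreover have "\<not> ?K (last p) (hd p)" if p: "longest_path ?V ?K p" for p
        using hamiltonian_if_longest_path_closes[OF symp_Gk_graph p _ n3]
          configuration_connected[OF c(1-3)] c(4) by blast
      ultimately have "blocked n a e"
        unfolding blocked_def Let_def using P[of ?c] by blast
      then show "e \<in> {e \<in> cfg n (\<lambda>v. N v - a v) (2 * m). blocked n a e}"
        using e by simp
    qed
    then have "card (?R a) \<le> card {e \<in> cfg n (\<lambda>v. N v - a v) (2 * m). blocked n a e}"
      by (rule card_mono[rotated], intro finite_subset[OF _ finite_cfg[of n "\<lambda>v. N v - a v" "2 * m"]])
        (use finite_N in auto)
    then have "real (card (?R a)) \<le> real (card {e \<in> cfg n (\<lambda>v. N v - a v) (2 * m). blocked n a e})"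
      by (simp only: of_nat_le_iff)
    also have "\<dots> \<le> q * real (card (cfg n (\<lambda>v. N v - a v) (2 * m)))"
      unfolding q_def by (rule card_blocked[OF a ex])
    also have "card (cfg n (\<lambda>v. N v - a v) (2 * m)) = D"
      unfolding D_def by (rule card_cfg_Diff[OF finite_N a])
    finally show ?thesis .
  qed
  have total: "real (card (cfg n N k1)) * real D = real (card (cfg n N \<kappa>)) * real ((\<kappa> choose k1) ^ n)"
  proof -
    have "card (cfg n N k1) * (\<Prod>v<n. card (N v) - k1 choose (\<kappa> - k1)) = card (cfg n N \<kappa>) * (\<kappa> choose k1) ^ n"
      by (intro card_cfg_mult finite_N k_le_degree) auto
    then have "card (cfg n N k1) * D = card (cfg n N \<kappa>) * (\<kappa> choose k1) ^ n"
      by (simp add: D_def)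
    then show ?thesis by (simp only: of_nat_mult[symmetric])
  qed
  have "card X * (\<kappa> - 2 choose (k1 - 2)) ^ n \<le> card (SIGMA a:cfg n N k1. ?R a)"
  proof (rule card_cfg_split[OF finite_N])
    fix c v assume "c \<in> X" "v < n"
    show "F c v \<subseteq> c v" by (auto simp: F_def)
    have d: "distinct (P c)" using P by (auto simp: longest_path_def path_in_def)
    have "card (F c v) \<le> card {w. path_adj (P c) v w}"
      using card_path_adj(1)[OF d] by (intro card_mono) (auto simp: F_def)
    then show "card (F c v) \<le> 2" using card_path_adj(2)[OF d, of v] by linarith
  qed (use k1 in \<open>auto simp: X_def\<close>)
  then have "real (card X) * real ((\<kappa> - 2 choose (k1 - 2)) ^ n) \<le> real (card (SIGMA a:cfg n N k1. ?R a))"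
    by (simp only: of_nat_mult[symmetric] of_nat_le_iff)
  also have "\<dots> = (\<Sum>a\<in>cfg n N k1. real (card (?R a)))"
    using finR finite_cfg[OF finite_N] by (simp add: card_SigmaI)
  also have "\<dots> \<le> (\<Sum>a\<in>cfg n N k1. q * real D)"
    by (rule sum_mono[OF R_bound])
  also have "\<dots> = q * (real (card (cfg n N k1)) * real D)" by simp
  also have "\<dots> = q * real (card (cfg n N \<kappa>)) * real ((\<kappa> choose k1) ^ n)"
    unfolding total by (simp only: mult.assoc)
  also have "\<dots> \<le> q * real (card (cfg n N \<kappa>)) * real ((12 * (\<kappa> - 2 choose (k1 - 2))) ^ n)"
  proof (rule mult_left_mono)
    have "(\<kappa> choose k1) ^ n \<le> (12 * (\<kappa> - 2 choose (k1 - 2))) ^ n"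
      using k1 by (intro power_mono choose_ratio) auto
    then show "real ((\<kappa> choose k1) ^ n) \<le> real ((12 * (\<kappa> - 2 choose (k1 - 2))) ^ n)"
      by (simp only: of_nat_le_iff)
  qed (use q0 in simp)
  also have "\<dots> = (12 ^ n * q * real (card (cfg n N \<kappa>))) * real ((\<kappa> - 2 choose (k1 - 2)) ^ n)"
    by (simp add: power_mult_distrib mult_ac)
  finally have "real (card X) \<le> 12 ^ n * q * real (card (cfg n N \<kappa>))"
    by (rule mult_right_le_imp_le) (use k1 in \<open>simp add: diff_le_mono\<close>)
  then show ?thesis by (simp only: X_def q_def)
qed

lemma card_nonhamiltonian:
  assumes "n \<ge> 3"
  shows "real (card {c \<in> cfg n N \<kappa>. \<not> hamiltonian n (Gk_graph c)})
    \<le> (96 / real n + (2 ^ n + 12 ^ n * (real n * 2 ^ n + 1)) * (\<rho> ^ m) ^ t) * real (card (cfg n N \<kappa>))"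
proof -
  let ?A = "{c \<in> cfg n N \<kappa>. concentrated c}" and ?B = "{c \<in> cfg n N \<kappa>. separated c}"
  let ?X = "{c \<in> cfg n N \<kappa>. \<not> concentrated c \<and> \<not> separated c \<and> \<not> hamiltonian n (Gk_graph c)}"
  have "card {c \<in> cfg n N \<kappa>. \<not> hamiltonian n (Gk_graph c)} \<le> card (?A \<union> (?B \<union> ?X))"
    using finite_cfg[OF finite_N, where k = \<kappa>] by (intro card_mono) auto
  also have "\<dots> \<le> card ?A + (card ?B + card ?X)"
    using card_Un_le[of ?A "?B \<union> ?X"] card_Un_le[of ?B ?X] by linarith
  finally have "real (card {c \<in> cfg n N \<kappa>. \<not> hamiltonian n (Gk_graph c)})
      \<le> real (card ?A) + (real (card ?B) + real (card ?X))"
    by (simp only: of_nat_add[symmetric] of_nat_le_iff)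
  also have "\<dots> \<le> 96 / real n * real (card (cfg n N \<kappa>)) + (2 ^ n * (\<rho> ^ m) ^ t * real (card (cfg n N \<kappa>)) +
      12 ^ n * ((real n * 2 ^ n + 1) * (\<rho> ^ m) ^ t) * real (card (cfg n N \<kappa>)))"
    by (intro add_mono card_concentrated card_separated card_connected_nonhamiltonian assms)
  finally show ?thesis by (simp only: algebra_simps)
qed

lemma card_cfg_pos: "0 < card (cfg n N \<kappa>)"
proof -
  have "card (cfg n N \<kappa>) = (\<Prod>v<n. card (N v) choose \<kappa>)"
    by (rule card_cfg[OF finite_N])
  then show ?thesis using k_le_degree by (auto intro!: prod_pos)
qed

end

section \<open>From counting bounds to the limit\<close>

text \<open>Rounding in \<open>n div 192\<close> costs at most 64^191. The base 1/64 beats the 12 *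
  2 = 24 per vertex from the splitting and the union bound.\<close>

lemma power_div_le:
  fixes \<delta> :: real
  assumes "0 \<le> \<delta>" "\<delta> \<le> (1 / 64) ^ 192"
  shows "\<delta> ^ (n div 192) \<le> 64 ^ 191 * (1 / 64) ^ n"
proof -
  have "\<delta> ^ (n div 192) \<le> ((1 / 64) ^ 192) ^ (n div 192)"
    using assms by (intro power_mono) auto
  also have "\<dots> = 64 ^ 191 * (1 / 64) ^ (192 * (n div 192) + 191)"
    by (simp only: power_mult power_add) (simp add: power_divide)
  also have "\<dots> \<le> 64 ^ 191 * (1 / 64) ^ n"
    by (intro mult_left_mono power_decreasing) auto
  finally show ?thesis .
qed

text \<open>A product of uniform distributions is uniform on the product set; the degree bound makes
  each factor nonempty.\<close>

lemma prob_eq_card_ratio: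
  assumes "\<And>v. v < n \<Longrightarrow> finite (nbrs n E v)" "\<And>v. v < n \<Longrightarrow> k \<le> card (nbrs n E v)"
  shows "prob_Gk_hamiltonian n E k =
    real (card {c \<in> cfg n (nbrs n E) k. hamiltonian n (Gk_graph c)}) / real (card (cfg n (nbrs n E) k))"
proof -
  have ne: "{S. S \<subseteq> nbrs n E v \<and> card S = k} \<noteq> {}" if "v < n" for v
    using obtain_subset_with_card_n[OF assms(2)[OF that]] by auto
  have "choice_pmf n E k = pmf_of_set (cfg n (nbrs n E) k)"
    unfolding choice_pmf_def cfg_def
    by (rule Pi_pmf_of_set) (use assms(1) ne in auto)
  moreover have "cfg n (nbrs n E) k \<noteq> {}"
    unfolding cfg_def using ne by auto
  moreover have "finite (cfg n (nbrs n E) k)"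
    by (rule finite_cfg[OF assms(1)])
  ultimately show ?thesis
    by (simp add: prob_Gk_hamiltonian_def measure_pmf_of_set Int_def conj_commute)
qed

theorem theorem2:
  fixes \<epsilon> :: real
  assumes "\<epsilon> > 0"
  shows "\<exists>k\<^sub>0::nat. \<forall>k\<ge>k\<^sub>0. \<forall>G :: nat \<Rightarrow> nat \<Rightarrow> nat \<Rightarrow> bool.
           (\<forall>n. is_graph n (G n)) \<longrightarrow>
           (\<forall>\<^sub>F n in sequentially. min_degree_ge n (G n) ((1/2 + \<epsilon>) * real n)) \<longrightarrow>
           ((\<lambda>n. prob_Gk_hamiltonian n (G n) k) \<longlonglongrightarrow> 1)"
proof -
  \<comment> \<open>Lowering \<epsilon> to at most 1/2 only weakens the degree condition.\<close>
  define \<eta> where "\<eta> = min \<epsilon> (1 / 2)"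
  have \<eta>: "0 < \<eta>" "\<eta> \<le> 1 / 2" "\<eta> \<le> \<epsilon>" using assms by (auto simp: \<eta>_def)
  obtain m\<^sub>0 where m\<^sub>0: "(1 - \<eta> / 4) ^ m\<^sub>0 < (1 / 64) ^ 192"
    using real_arch_pow_inv[of "(1 / 64) ^ 192" "1 - \<eta> / 4"] \<eta> by auto
  \<comment> \<open>The bases are 2/64, 24/64 and 12/64, from expanding the error factor times
    (1/64)^n.\<close>
  define err :: "nat \<Rightarrow> real" where
    "err n = 96 / real n + 64 ^ 191 * ((1 / 32) ^ n + (real n * (3 / 8) ^ n + (3 / 16) ^ n))" for n
  have err: "err \<longlonglongrightarrow> 0"
    unfolding err_def
    by (intro tendsto_add_zero tendsto_mult_right_zero LIMSEQ_realpow_zero powser_times_n_limit_0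
        lim_const_over_n) auto
  show ?thesis
  \<comment> \<open>51 = 3 * 17 yields \<open>17 \<le> k1\<close>, and 3 times
    \<open>m\<^sub>0\<close> yields that \<open>m\<close> is at least
    \<open>m\<^sub>0\<close>.\<close>
  proof (intro exI[of _ "max (3 * m\<^sub>0) 51"] allI impI)
    fix k :: nat and G :: "nat \<Rightarrow> nat \<Rightarrow> nat \<Rightarrow> bool"
    assume k: "max (3 * m\<^sub>0) 51 \<le> k"
      and "\<forall>\<^sub>F n in sequentially. min_degree_ge n (G n) ((1/2 + \<epsilon>) * real n)"
    define m where "m = k div 3"
    \<comment> \<open>\<open>k1\<close> takes the remainder of the division by 3, whence
      \<open>m \<le> k1\<close>.\<close>
    define k1 where "k1 = k - 2 * m"
    have km: "k1 + 2 * m = k" "17 \<le> k1" "m \<le> k1" "m\<^sub>0 \<le> m"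
      using k unfolding k1_def m_def by linarith+
    \<comment> \<open>This is the locale assumption \<open>big\<close>, solved for n.\<close>
    have "\<forall>\<^sub>F n in sequentially. 4 * (real k + 1) / \<eta> \<le> real n"
      using filterlim_real_sequentially unfolding filterlim_at_top by blast
    moreover have "\<forall>\<^sub>F n in sequentially. 3 \<le> n"
      by (rule eventually_ge_at_top)
    moreover note \<open>\<forall>\<^sub>F n in sequentially. min_degree_ge n (G n) ((1/2 + \<epsilon>) * real n)\<close>
    ultimately have lower: "\<forall>\<^sub>F n in sequentially. 1 - err n \<le> prob_Gk_hamiltonian n (G n) k"
    proof eventually_elim
      case (elim n)
      let ?N = "nbrs n (G n)"
      interpret dense_neighbourhoods n k1 m ?N \<eta>
      proof
        fix v assume "v < n"
        then have "(1 / 2 + \<epsilon>) * real n \<le> real (card (?N v))"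
          using elim(3) by (auto simp: min_degree_ge_def)
        moreover have "(1 / 2 + \<eta>) * real n \<le> (1 / 2 + \<epsilon>) * real n"
          using \<eta> by (intro mult_right_mono) auto
        ultimately show "(1 / 2 + \<eta>) * real n \<le> real (card (?N v))" by linarith
      next
        have "real k = real k1 + 2 * real m" using km(1) by linarith
        then show "4 * (real k1 + 2 * real m + 1) \<le> \<eta> * real n"
          using elim(1) \<eta> by (simp add: field_simps)
      qed (use \<eta> km in \<open>auto simp: nbrs_def\<close>)
      let ?C = "cfg n ?N k"
      let ?H = "{c \<in> ?C. hamiltonian n (Gk_graph c)}" and ?X = "{c \<in> ?C. \<not> hamiltonian n (Gk_graph c)}"
      have finC: "finite ?C" by (rule finite_cfg[OF finite_N])
      have C0: "0 < real (card ?C)" using card_cfg_pos by (simp add: km(1))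
      have "card ?C = card ?H + card ?X"
        using finC by (subst card_Un_disjoint[symmetric]) (auto intro!: arg_cong[where f = card])
      then have H: "real (card ?H) = real (card ?C) - real (card ?X)" by linarith
      have "(1 - \<eta> / 4) ^ m \<le> (1 - \<eta> / 4) ^ m\<^sub>0"
        using km(4) \<rho> by (intro power_decreasing) auto
      then have "((1 - \<eta> / 4) ^ m) ^ (n div 192) \<le> 64 ^ 191 * (1 / 64) ^ n"
        using m\<^sub>0 \<rho> by (intro power_div_le) auto
      then have "(2 ^ n + 12 ^ n * (real n * 2 ^ n + 1)) * ((1 - \<eta> / 4) ^ m) ^ (n div 192)
          \<le> (2 ^ n + 12 ^ n * (real n * 2 ^ n + 1)) * (64 ^ 191 * (1 / 64) ^ n)"
        by (rule mult_left_mono) simp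
      also have "\<dots> = 64 ^ 191 * ((2 * (1 / 64)) ^ n + (real n * (12 * 2 * (1 / 64)) ^ n + (12 * (1 / 64)) ^ n))"
        by (simp only: power_mult_distrib algebra_simps mult_1_right)
      also have "\<dots> = 64 ^ 191 * ((1 / 32) ^ n + (real n * (3 / 8) ^ n + (3 / 16) ^ n))"
        by simp
      finally have "96 / real n + (2 ^ n + 12 ^ n * (real n * 2 ^ n + 1)) * ((1 - \<eta> / 4) ^ m) ^ (n div 192) \<le> err n"
        by (simp only: err_def add_left_mono)
      then have "real (card ?X) \<le> err n * real (card ?C)"
        using order_trans[OF card_nonhamiltonian[OF elim(2)] mult_right_mono] C0 km(1) by simp
      then have "(1 - err n) * real (card ?C) \<le> real (card ?H)"
        unfolding H by (simp add: algebra_simps)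
      moreover have "prob_Gk_hamiltonian n (G n) k = real (card ?H) / real (card ?C)"
        using k_le_degree km(1) finite_N by (intro prob_eq_card_ratio) auto
      ultimately show ?case
        using C0 by (simp add: pos_le_divide_eq)
    qed
    have "(\<lambda>n. 1 - err n) \<longlonglongrightarrow> 1"
      using tendsto_diff[OF tendsto_const err, of 1] by simp
    moreover have "\<forall>\<^sub>F n in sequentially. prob_Gk_hamiltonian n (G n) k \<le> 1"
      by (simp add: prob_Gk_hamiltonian_def)
    ultimately show "(\<lambda>n. prob_Gk_hamiltonian n (G n) k) \<longlonglongrightarrow> 1"
      using tendsto_sandwich[OF lower _ _ tendsto_const] by blast
  qed
qed

end
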